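(* Let $\mathcal{A}\in\mathbb{C}^{n_1\times n_1\times n_3}$. Suppose $\mathcal{A}$ has the C-HS decomposition $$\mathcal{A}=\mathcal{U}*_c\begin{bmatrix}\mathcal{S}_r*_c\mathcal{K} & \mathcal{S}_r*_c\mathcal{L}\\ \mathcal{O}&\mathcal{O}\end{bmatrix}*_c\mathcal{U}^H.$$ Then $$\mathcal{A}^D=\mathcal{U}*_c\begin{bmatrix}(\mathcal{S}_r*_c\mathcal{K})^D & ((\mathcal{S}_r*_c\mathcal{K})^D)^2*_c\mathcal{S}_r*_c\mathcal{L}\\ \mathcal{O}&\mathcal{O}\end{bmatrix}*_c\mathcal{U}^H.$$
   Context: For a third-order tensor $\mathcal{A}\in\mathbb{C}^{n_1\times n_2\times n_3}$, $\mathcal{A}^{(i)}=\mathcal{A}(:,:,i)\in\mathbb{C}^{n_1\times n_2}$ denotes its $i$-th frontal slice. Let $\mathbf{C}_{n_3}$ be the $n_3\times n_3$ orthogonal DCT matrix, with entries $(\mathbf{C}_{n_3})_{jk}=\sqrt{(2-\delta_{j1})/n_3}\,\cos\big(\tfrac{(j-1)(2k-1)\pi}{2n_3}\big)$; let $\mathbf{W}$ be the diagonal matrix whose diagonal is the first column of $\mathbf{C}_{n_3}$; let $\mathbf{Z}$ be the $n_3\times n_3$ matrix with ones on the first superdiagonal and zeros elsewhere; and put $\mathbf{M}=\mathbf{W}^{-1}\mathbf{C}_{n_3}(\mathbf{I}+\mathbf{Z})$, an invertible matrix. Define the linear bijection $L$ on tensors with third dimension $n_3$ by $L(\mathcal{A})_{ijk}=\sum_{l=1}^{n_3}\mathbf{M}_{kl}\mathcal{A}_{ijl}$.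 The C-product of $\mathcal{A}\in\mathbb{C}^{n_1\times n_2\times n_3}$ and $\mathcal{B}\in\mathbb{C}^{n_2\times l\times n_3}$ is the tensor $\mathcal{A}*_c\mathcal{B}\in\mathbb{C}^{n_1\times l\times n_3}$ determined by $L(\mathcal{A}*_c\mathcal{B})^{(i)}=L(\mathcal{A})^{(i)}L(\mathcal{B})^{(i)}$, $i=1,\dots,n_3$. The conjugate transpose $\mathcal{A}^H$ is determined by $L(\mathcal{A}^H)^{(i)}=(L(\mathcal{A})^{(i)})^H$ for all $i$. The identity tensor $\mathcal{I}\in\mathbb{C}^{n\times n\times n_3}$ is determined by $L(\mathcal{I})^{(i)}=\mathbf{I}_n$ for all $i$. Powers are with respect to $*_c$, with $\mathcal{A}^0=\mathcal{I}$. A tensor $\mathcal{B}\in\mathbb{C}^{n\times n\times n_3}$ is invertible if there is $\mathcal{B}^{-1}$ with $\mathcal{B}*_c\mathcal{B}^{-1}=\mathcal{B}^{-1}*_c\mathcal{B}=\mathcal{I}$, and unitary if $\mathcal{B}^H*_c\mathcal{B}=\mathcal{B}*_c\mathcal{B}^H=\mathcal{I}$. A tensor is F-diagonal if all its frontal slices are diagonal. Block notation partitions tensors along the first two modes; $\mathcal{O}$ denotes zero tensors. C-HS decomposition: let $\mathcal{A}\in\mathbb{C}^{n_1\times n_1\times n_3}$ have a C-SVD $\mathcal{A}=\mathcal{U}*_c\mathcal{S}*_c\mathcal{V}^H$ ($\mathcal{U},\mathcal{V}\in\mathbb{C}^{n_1\times n_1\times n_3}$ unitary, $\mathcal{S}$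 F-diagonal) in which all $L(\mathcal{S})^{(i)}$, $i=1,\dots,n_3$, have the same rank $r$, so that $\mathcal{S}=\begin{bmatrix}\mathcal{S}_r&\mathcal{O}\\ \mathcal{O}&\mathcal{O}\end{bmatrix}$ with $\mathcal{S}_r\in\mathbb{C}^{r\times r\times n_3}$ F-diagonal and invertible. Write $\mathcal{V}^H*_c\mathcal{U}=\begin{bmatrix}\mathcal{K}&\mathcal{L}\\ \mathcal{M}&\mathcal{N}\end{bmatrix}$ with $\mathcal{K}\in\mathbb{C}^{r\times r\times n_3}$, $\mathcal{L}\in\mathbb{C}^{r\times(n_1-r)\times n_3}$. Then $\mathcal{A}=\mathcal{U}*_c\begin{bmatrix}\mathcal{S}_r*_c\mathcal{K}&\mathcal{S}_r*_c\mathcal{L}\\ \mathcal{O}&\mathcal{O}\end{bmatrix}*_c\mathcal{U}^H$ with $\mathcal{K}*_c\mathcal{K}^H+\mathcal{L}*_c\mathcal{L}^H=\mathcal{I}_r$ (the identity tensor in $\mathbb{C}^{r\times r\times n_3}$); this is called the C-HS decomposition of $\mathcal{A}$. $\mathrm{mat}(\mathcal{A})$ is the $n_3\times n_3$ block Toeplitz-plus-Hankel matrix whose $(p,q)$ block is $\mathcal{A}^{(|p-q|+1)}+\mathbf{H}_{pq}$, where $\mathbf{H}_{pq}=\mathcal{A}^{(p+q)}$ if $p+q\le n_3$, $\mathbf{H}_{pq}=O$ if $p+q=n_3+1$, and $\mathbf{H}_{pq}=\mathcal{A}^{(2n_3+2-p-q)}$ if $p+q\ge n_3+2$. The index $\mathrm{Ind}(A)$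 of a square matrix $A$ is the smallest nonnegative integer $k$ with $\mathrm{rank}(A^k)=\mathrm{rank}(A^{k+1})$, and $\mathrm{Ind}(\mathcal{A})=\mathrm{Ind}(\mathrm{mat}(\mathcal{A}))$. If $\mathrm{Ind}(\mathcal{A})=k$, the Drazin inverse $\mathcal{A}^D$ is the (unique) tensor $\mathcal{X}$ of the same size with $\mathcal{A}^{k+1}*_c\mathcal{X}=\mathcal{A}^k$, $\mathcal{X}*_c\mathcal{A}*_c\mathcal{X}=\mathcal{X}$, $\mathcal{A}*_c\mathcal{X}=\mathcal{X}*_c\mathcal{A}$. *)

theory Defs
  imports
    "Jordan_Normal_Form.DL_Rank"
    "Jordan_Normal_Form.Gauss_Jordan_Elimination"
    "Jordan_Normal_Form.Schur_Decomposition"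
    Complex_Main
begin

text \<open>
  A third-order tensor is the list of its frontal slices. All indices are shifted to start at 0,
  so that \<open>A ! k\<close> is the slice \<open>A(:,:,k+1)\<close> of the mathematical notation. The third dimension is
  the length of the list, which has to be positive for the first two dimensions to be readable
  from the list.
\<close>

type_synonym tensor = "complex mat list"

definition tensors :: "nat \<Rightarrow> nat \<Rightarrow> nat \<Rightarrow> tensor set" where
  "tensors n1 n2 n3 = {A. length A = n3 \<and> (\<forall>i<n3. A ! i \<in> carrier_mat n1 n2)}"

definition tensor_rows :: "tensor \<Rightarrow> nat" where
  "tensor_rows A = dim_row (A ! 0)"

definition tensor_cols :: "tensor \<Rightarrow> nat" where
  "tensor_cols A = dim_col (A ! 0)"

definition dct_mat :: "nat \<Rightarrow> complex mat" where
  "dct_mat n = mat n n (\<lambda>(j, k). complex_of_real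
     (sqrt ((if j = 0 then 1 else 2) / real n) * cos (real j * (2 * real k + 1) * pi / (2 * real n))))"

definition dct_weight_mat :: "nat \<Rightarrow> complex mat" where
  "dct_weight_mat n = mat_diag n (\<lambda>j. dct_mat n $$ (j, 0))"

definition upshift_mat :: "nat \<Rightarrow> complex mat" where
  "upshift_mat n = mat n n (\<lambda>(i, j). if j = i + 1 then 1 else 0)"

text \<open>
  The diagonal entries of the weight matrix are nonzero, so that \<^const>\<open>mat_inverse\<close> returns
  its inverse.
\<close>

definition transform_mat :: "nat \<Rightarrow> complex mat" where
  "transform_mat n = the (mat_inverse (dct_weight_mat n)) * dct_mat n * (1\<^sub>m n + upshift_mat n)"

definition cosine_transform :: "tensor \<Rightarrow> tensor" where
  "cosine_transform A =
     map (\<lambda>k. mat (tensor_rows A) (tensor_cols A)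
               (\<lambda>(i, j). \<Sum>l<length A. transform_mat (length A) $$ (k, l) * A ! l $$ (i, j)))
         [0..<length A]"

text \<open>
  The operations below are introduced by their values under the transform; these determine
  a unique tensor because the transform is bijective.
\<close>

definition c_product :: "tensor \<Rightarrow> tensor \<Rightarrow> tensor" (infixl \<open>*\<^sub>c\<close> 70) where
  "A *\<^sub>c B = (THE C. C \<in> tensors (tensor_rows A) (tensor_cols B) (length A) \<and>
     (\<forall>i<length A. cosine_transform C ! i = cosine_transform A ! i * cosine_transform B ! i))"

definition conj_transpose :: "tensor \<Rightarrow> tensor" (\<open>_\<^sup>H\<close> [1000] 999) where
  "A\<^sup>H = (THE C. C \<in> tensors (tensor_cols A) (tensor_rows A) (length A) \<and>
     (\<forall>i<length A. cosine_transform C ! i = mat_adjoint (cosine_transform A ! i)))"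

definition id_tensor :: "nat \<Rightarrow> nat \<Rightarrow> tensor" where
  "id_tensor n n3 = (THE C. C \<in> tensors n n n3 \<and> (\<forall>i<n3. cosine_transform C ! i = 1\<^sub>m n))"

definition zero_tensor :: "nat \<Rightarrow> nat \<Rightarrow> nat \<Rightarrow> tensor" where
  "zero_tensor n1 n2 n3 = replicate n3 (0\<^sub>m n1 n2)"

definition add_tensor :: "tensor \<Rightarrow> tensor \<Rightarrow> tensor" (infixl \<open>+\<^sub>c\<close> 65) where
  "A +\<^sub>c B = map2 (+) A B"

primrec tensor_pow :: "tensor \<Rightarrow> nat \<Rightarrow> tensor" (infixr \<open>^\<^sub>c\<close> 75) where
  "A ^\<^sub>c 0 = id_tensor (tensor_rows A) (length A)"
| "A ^\<^sub>c Suc k = A ^\<^sub>c k *\<^sub>c A"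

definition block_tensor :: "tensor \<Rightarrow> tensor \<Rightarrow> tensor \<Rightarrow> tensor \<Rightarrow> tensor" where
  "block_tensor A B C D =
     map (\<lambda>i. four_block_mat (A ! i) (B ! i) (C ! i) (D ! i)) [0..<length A]"

definition invertible_tensor :: "nat \<Rightarrow> nat \<Rightarrow> tensor \<Rightarrow> bool" where
  "invertible_tensor n n3 B \<longleftrightarrow> B \<in> tensors n n n3 \<and>
     (\<exists>C \<in> tensors n n n3. B *\<^sub>c C = id_tensor n n3 \<and> C *\<^sub>c B = id_tensor n n3)"

definition unitary_tensor :: "nat \<Rightarrow> nat \<Rightarrow> tensor \<Rightarrow> bool" where
  "unitary_tensor n n3 B \<longleftrightarrow> B \<in> tensors n n n3 \<and>
     B\<^sup>H *\<^sub>c B = id_tensor n n3 \<and> B *\<^sub>c B\<^sup>H = id_tensor n n3"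

definition F_diagonal :: "tensor \<Rightarrow> bool" where
  "F_diagonal A \<longleftrightarrow> (\<forall>i<length A. diagonal_mat (A ! i))"

definition is_C_SVD :: "nat \<Rightarrow> nat \<Rightarrow> tensor \<Rightarrow> tensor \<Rightarrow> tensor \<Rightarrow> tensor \<Rightarrow> bool" where
  "is_C_SVD n n3 A U S V \<longleftrightarrow>
     unitary_tensor n n3 U \<and> unitary_tensor n n3 V \<and>
     S \<in> tensors n n n3 \<and> F_diagonal S \<and> A = U *\<^sub>c S *\<^sub>c V\<^sup>H"

text \<open>
  The last two equations follow from the other clauses; they are part of the notion because they
  are what is called the C-HS decomposition.
\<close>

definition is_C_HS ::
  "nat \<Rightarrow> nat \<Rightarrow> nat \<Rightarrow> tensor \<Rightarrow> tensor \<Rightarrow> tensor \<Rightarrow> tensor \<Rightarrow> tensor \<Rightarrow> bool" where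
  "is_C_HS n n3 r A U Sr K L \<longleftrightarrow> r \<le> n \<and>
     (\<exists>S V M N.
        is_C_SVD n n3 A U S V \<and>
        (\<forall>i<n3. vec_space.rank n (cosine_transform S ! i) = r) \<and>
        S = block_tensor Sr (zero_tensor r (n - r) n3)
              (zero_tensor (n - r) r n3) (zero_tensor (n - r) (n - r) n3) \<and>
        F_diagonal Sr \<and> invertible_tensor r n3 Sr \<and>
        K \<in> tensors r r n3 \<and> L \<in> tensors r (n - r) n3 \<and>
        M \<in> tensors (n - r) r n3 \<and> N \<in> tensors (n - r) (n - r) n3 \<and>
        V\<^sup>H *\<^sub>c U = block_tensor K L M N) \<and>
     A = U *\<^sub>c block_tensor (Sr *\<^sub>c K) (Sr *\<^sub>c L)
                 (zero_tensor (n - r) r n3) (zero_tensor (n - r) (n - r) n3) *\<^sub>c U\<^sup>H \<and>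
     K *\<^sub>c K\<^sup>H +\<^sub>c L *\<^sub>c L\<^sup>H = id_tensor r n3"

text \<open>
  The block Toeplitz-plus-Hankel matrix. With 0-based block indices \<open>p\<close>, \<open>q\<close>, the mathematical
  condition \<open>p + q \<le> n\<^sub>3\<close> becomes \<open>p + q + 2 \<le> n3\<close>, and the slice numbers \<open>p + q\<close> and
  \<open>2 n\<^sub>3 + 2 - p - q\<close> become \<open>p + q + 1\<close> and \<open>2 * n3 - 1 - p - q\<close>.
\<close>

definition hankel_block :: "tensor \<Rightarrow> nat \<Rightarrow> nat \<Rightarrow> complex mat" where
  "hankel_block A p q = (let n3 = length A in
     if p + q + 2 \<le> n3 then A ! (p + q + 1)
     else if p + q + 2 = n3 + 1 then 0\<^sub>m (tensor_rows A) (tensor_cols A)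
     else A ! (2 * n3 - 1 - p - q))"

definition toeplitz_block :: "tensor \<Rightarrow> nat \<Rightarrow> nat \<Rightarrow> complex mat" where
  "toeplitz_block A p q = A ! (if p \<le> q then q - p else p - q)"

definition tensor_mat :: "tensor \<Rightarrow> complex mat" where
  "tensor_mat A = (let n1 = tensor_rows A; n2 = tensor_cols A in
     mat (length A * n1) (length A * n2)
       (\<lambda>(a, b). (toeplitz_block A (a div n1) (b div n2) + hankel_block A (a div n1) (b div n2))
                   $$ (a mod n1, b mod n2)))"

definition mat_index :: "complex mat \<Rightarrow> nat" where
  "mat_index A = (LEAST k. vec_space.rank (dim_row A) (A ^\<^sub>m k) =
                           vec_space.rank (dim_row A) (A ^\<^sub>m (k + 1)))"

definition tensor_index :: "tensor \<Rightarrow> nat" where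
  "tensor_index A = mat_index (tensor_mat A)"

definition is_drazin_inverse :: "tensor \<Rightarrow> tensor \<Rightarrow> bool" where
  "is_drazin_inverse A X \<longleftrightarrow>
     X \<in> tensors (tensor_rows A) (tensor_cols A) (length A) \<and>
     A ^\<^sub>c (tensor_index A + 1) *\<^sub>c X = A ^\<^sub>c tensor_index A \<and>
     X *\<^sub>c A *\<^sub>c X = X \<and>
     A *\<^sub>c X = X *\<^sub>c A"

definition drazin_inverse :: "tensor \<Rightarrow> tensor" (\<open>_\<^sup>D\<close> [1000] 999) where
  "A\<^sup>D = (THE X. is_drazin_inverse A X)"

end

theory Submission
  imports Defs
begin

text \<open>
  The transform \<open>L\<close> carries the C-product, the conjugate transpose and the identity tensor to
  the same operations on the frontal slices, and it is a bijection. So the tensors of size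
  \<open>n \<times> n \<times> n\<^sub>3\<close> form a product of \<open>n\<^sub>3\<close> copies of the algebra of complex matrices, and every
  equation between tensors can be checked one slice of the transform at a time. For matrices the
  formula is a short computation: if \<open>X\<close> is the Drazin inverse of \<open>B\<close>, then
  the block matrix with top row \<open>(X, X\<^sup>2C)\<close> and zeros below is a Drazin inverse of the one with top
  row \<open>(B, C)\<close> and zeros below, because for \<open>k \<ge> 1\<close> the \<open>k\<close>-th power of the latter has top row
  \<open>(B\<^sup>k, B\<^sup>k\<^sup>-\<^sup>1C)\<close> (\<open>block_row_drazin\<close>). Conjugating with the unitary \<open>U\<close> and taking
  \<open>B = S\<^sub>r K\<close>, \<open>C = S\<^sub>r L\<close> gives the theorem.

  The difficulty is the exponent in the equation \<open>A\<^sup>k\<^sup>+\<^sup>1 X = A\<^sup>k\<close>. The definition prescribes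
  \<open>k = Ind(mat(A))\<close>, the index of a large block Toeplitz-plus-Hankel matrix, whereas the
  computation above yields the equation only for large \<open>k\<close>. Two facts close the gap.

  First, the exponent is immaterial as long as it is at least the index. In any monoid an element
  has at most one \<open>X\<close> satisfying the Drazin equations with some exponent (\<open>drazin_unique\<close>), and as soon
  as \<open>a\<^sup>k\<close> is a right multiple of \<open>a\<^sup>k\<^sup>+\<^sup>1\<close> this \<open>X\<close> also satisfies the equation
  with exponent \<open>k\<close> (\<open>drazin_absorb_at_index\<close>). For a matrix, equality of the ranks
  of \<open>a\<^sup>k\<close> and \<open>a\<^sup>k\<^sup>+\<^sup>1\<close> says that their column spaces agree, which is exactly that divisibility
  (\<open>mat_index_absorb\<close>).

  Second, \<open>mat\<close> is an injective homomorphism from tensors to matrices, so the equation at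
  exponent \<open>Ind(mat(A))\<close> can be proved for matrices and pulled back. The reason is that the rows
  of the cosine matrix are left eigenvectors of every scalar Toeplitz-plus-Hankel matrix, with
  the transform values as eigenvalues (\<open>dct_left_eigenvector\<close>, from the product formula
  \<open>2 cos a cos b = cos (a + b) + cos (a - b)\<close>). Hence \<open>mat(A)\<close> is the orthogonal conjugate, by the cosine
  matrix, of the block diagonal matrix of the slices of \<open>L(A)\<close> (\<open>tensor_mat_spectral\<close>).

  Existence of the Drazin inverses also comes from ranks: the ranks of the powers of a matrix and
  of its transpose stabilise, so some power \<open>a\<^sup>k\<close> is a right multiple of \<open>a\<^sup>k\<^sup>+\<^sup>1\<close> and some
  power \<open>a\<^sup>l\<close> is a left multiple of \<open>a\<^sup>l\<^sup>+\<^sup>1\<close>, and in any monoid this is enough (\<open>drazin_exists\<close>).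
\<close>

section \<open>Orthogonality of the discrete cosine matrix\<close>

text \<open>
  With \<open>t = m\<pi> / 2n\<close>, multiplying by \<open>2 sin t\<close> makes the sum telescope to \<open>sin (m\<pi>) = 0\<close>, and
  \<open>sin t\<close> is positive because \<open>0 < t < \<pi>\<close>.
\<close>

lemma sum_cos_odd_multiples:
  fixes n m :: nat
  assumes "0 < m" "m < 2 * n"
  shows "(\<Sum>k<n. cos (real m * (2 * real k + 1) * pi / (2 * real n))) = 0"
proof -
  define t where "t = real m * pi / (2 * real n)"
  have n: "n > 0" using assms by simp
  have "t > 0" using assms n by (simp add: t_def)
  moreover have "real m * pi < (2 * real n) * pi"
    by (rule mult_strict_right_mono[OF _ pi_gt_zero]) (use assms in linarith)
  hence "t < pi" using n by (simp add: t_def field_simps)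
  ultimately have s: "sin t > 0" by (rule sin_gt_zero)
  have "2 * sin t * (\<Sum>k<n. cos (real m * (2 * real k + 1) * pi / (2 * real n)))
      = (\<Sum>k<n. sin (2 * t * real (Suc k)) - sin (2 * t * real k))"
    unfolding sum_distrib_left
  proof (rule sum.cong[OF refl])
    fix k
    have 1: "real m * (2 * real k + 1) * pi / (2 * real n) = 2 * t * real k + t"
      using n by (simp add: t_def field_simps)
    have 2: "2 * t * real (Suc k) = (2 * t * real k + t) + t"
      and 3: "2 * t * real k = (2 * t * real k + t) - t" by (simp_all add: algebra_simps)
    show "2 * sin t * cos (real m * (2 * real k + 1) * pi / (2 * real n))
      = sin (2 * t * real (Suc k)) - sin (2 * t * real k)"
      unfolding 1 by (subst 2, subst (2) 3, unfold sin_add[of "2 * t * real k + t" t] sin_diff[of "2 * t * real k + t" t]) simp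
  qed
  also have "\<dots> = sin (2 * t * real n)"
    by (subst sum_lessThan_telescope) simp
  also have "2 * t * real n = real m * pi" using n by (simp add: t_def)
  finally show ?thesis using s by simp
qed

text \<open>
  The entries of the cosine matrix as real numbers, so that the trigonometric identities apply
  before the embedding into the complex numbers.
\<close>

definition dct_entry :: "nat \<Rightarrow> nat \<Rightarrow> nat \<Rightarrow> real" where
  "dct_entry n j k = sqrt ((if j = 0 then 1 else 2) / real n)
     * cos (real j * (2 * real k + 1) * pi / (2 * real n))"

lemma dct_mat_carrier [simp]: "dct_mat n \<in> carrier_mat n n"
  by (simp add: dct_mat_def)

text \<open>
  The product of two cosines is half the cosine of the difference plus half the cosine of the sum
  of the arguments. Both sums over \<open>k\<close> vanish by the previous lemma unless a frequency is \<open>0\<close>,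
  and the weights are chosen so that the remaining cases give \<open>1\<close>.
\<close>

lemma dct_rows_orthonormal:
  assumes "i < n" "j < n"
  shows "(\<Sum>k<n. dct_entry n i k * dct_entry n j k) = (if i = j then 1 else 0)"
proof -
  define c where "c = (\<lambda>i::nat. sqrt ((if i = 0 then 1 else 2) / real n))"
  define s where "s = (\<lambda>m. \<Sum>k<n. cos (real m * (2 * real k + 1) * pi / (2 * real n)))"
  have n: "n > 0" using assms by simp
  have main: "(\<Sum>k<n. dct_entry n i k * dct_entry n j k) = c i * c j * (s (i - j) + s (i + j)) / 2"
    if "j \<le> i" for i j
  proof -
    have "dct_entry n i k * dct_entry n j k = c i * c j / 2 *
       (cos (real (i - j) * (2 * real k + 1) * pi / (2 * real n))
        + cos (real (i + j) * (2 * real k + 1) * pi / (2 * real n)))" for k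
    proof -
      let ?a = "real i * (2 * real k + 1) * pi / (2 * real n)"
      let ?b = "real j * (2 * real k + 1) * pi / (2 * real n)"
      have 1: "real (i - j) * (2 * real k + 1) * pi / (2 * real n) = ?a - ?b"
        using that by (simp add: of_nat_diff left_diff_distrib diff_divide_distrib)
      have 2: "real (i + j) * (2 * real k + 1) * pi / (2 * real n) = ?a + ?b"
        by (simp add: distrib_right add_divide_distrib)
      have 3: "dct_entry n i k = c i * cos ?a" "dct_entry n j k = c j * cos ?b"
        by (simp_all add: dct_entry_def c_def)
      show ?thesis unfolding 1 2 3 cos_add cos_diff by simp
    qed
    thus ?thesis
      by (simp only: sum_distrib_left[symmetric] sum.distrib s_def) simp
  qed
  have s0: "s m = 0" if "0 < m" "m < 2 * n" for m
    using sum_cos_odd_multiples[OF that] by (simp add: s_def)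
  have s00: "s 0 = n" by (simp add: s_def)
  have c0: "c i * c i = (if i = 0 then 1 else 2) / real n" for i by (simp add: c_def)
  have *: "(\<Sum>k<n. dct_entry n i k * dct_entry n j k) = (if i = j then 1 else 0)"
    if "j \<le> i" "i < n" for i j
  proof (cases "i = j")
    case True
    show ?thesis
    proof (cases "i = 0")
      case True
      thus ?thesis using n \<open>i = j\<close> unfolding main[OF that(1)] by (simp add: c0 s00)
    next
      case False
      hence "s (i + i) = 0" using s0[of "i + i"] that by simp
      thus ?thesis using n \<open>i = j\<close> \<open>i \<noteq> 0\<close> unfolding main[OF that(1)] by (simp add: c0 s00)
    qed
  next
    case False
    thus ?thesis using main[OF that(1)] s0[of "i + j"] s0[of "i - j"] that by simp
  qed
  show ?thesis
  proof (cases "j \<le> i")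
    case True thus ?thesis using * assms by blast
  next
    case False
    thus ?thesis using *[of i j] assms by (auto simp: mult.commute)
  qed
qed

lemma dct_mat_entry: "j < n \<Longrightarrow> k < n \<Longrightarrow> dct_mat n $$ (j, k) = complex_of_real (dct_entry n j k)"
  by (simp add: dct_mat_def dct_entry_def)

lemma dct_mat_orthogonal:
  "dct_mat n * transpose_mat (dct_mat n) = 1\<^sub>m n" "transpose_mat (dct_mat n) * dct_mat n = 1\<^sub>m n"
proof -
  show *: "dct_mat n * transpose_mat (dct_mat n) = 1\<^sub>m n"
  proof (rule eq_matI)
    fix i j assume "i < dim_row (1\<^sub>m n :: complex mat)" "j < dim_col (1\<^sub>m n :: complex mat)"
    hence ij: "i < n" "j < n" by auto
    have "(dct_mat n * transpose_mat (dct_mat n)) $$ (i, j)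
        = (\<Sum>k<n. dct_mat n $$ (i, k) * dct_mat n $$ (j, k))"
      using ij carrier_matD[OF dct_mat_carrier[of n]] by (simp add: scalar_prod_def atLeast0LessThan)
    also have "\<dots> = complex_of_real (\<Sum>k<n. dct_entry n i k * dct_entry n j k)"
      using ij by (simp add: dct_mat_entry)
    finally show "(dct_mat n * transpose_mat (dct_mat n)) $$ (i, j) = 1\<^sub>m n $$ (i, j)"
      using ij by (simp add: dct_rows_orthonormal)
  qed (use carrier_matD[OF dct_mat_carrier[of n]] in auto)
  show "transpose_mat (dct_mat n) * dct_mat n = 1\<^sub>m n"
    by (rule mat_mult_left_right_inverse[OF _ _ *]) auto
qed

text \<open>
  Orthonormal rows of a square matrix force orthonormal columns.
\<close>

lemma dct_columns_orthonormal:
  assumes "p < n" "q < n"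
  shows "(\<Sum>j<n. complex_of_real (dct_entry n j p) * complex_of_real (dct_entry n j q)) = (if p = q then 1 else 0)"
proof -
  have "(\<Sum>j<n. complex_of_real (dct_entry n j p) * complex_of_real (dct_entry n j q)) = (transpose_mat (dct_mat n) * dct_mat n) $$ (p, q)"
    using assms carrier_matD[OF dct_mat_carrier[of n]]
    by (simp add: scalar_prod_def atLeast0LessThan dct_mat_entry)
  thus ?thesis using assms by (simp add: dct_mat_orthogonal)
qed

lemma dct_first_column_nonzero:
  assumes "j < n"
  shows "dct_entry n j 0 \<noteq> 0"
proof -
  have "real j * pi < real n * pi" using assms by (intro mult_strict_right_mono) auto
  hence "real j * pi / (2 * real n) < pi / 2" using assms by (simp add: field_simps)
  moreover have "0 \<le> real j * pi / (2 * real n)" by simp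
  ultimately have "cos (real j * pi / (2 * real n)) > 0"
    by (intro cos_gt_zero_pi) (linarith, simp)
  thus ?thesis using assms by (simp add: dct_entry_def)
qed

section \<open>The transform is a bijection\<close>

lemma dct_weight_inverse:
  "the (mat_inverse (dct_weight_mat n)) = mat_diag n (\<lambda>j. inverse (complex_of_real (dct_entry n j 0)))"
  (is "_ = ?D")
proof -
  have W: "dct_weight_mat n = mat_diag n (\<lambda>j. complex_of_real (dct_entry n j 0))"
    unfolding dct_weight_mat_def mat_diag_def by (intro cong_mat) (auto simp: dct_mat_entry)
  have Wc: "dct_weight_mat n \<in> carrier_mat n n" by (simp add: W)
  have one: "?D * dct_weight_mat n = 1\<^sub>m n" 
    unfolding W mat_diag_diag mat_diag_one[symmetric]
    unfolding mat_diag_def by (intro cong_mat) (auto simp: dct_first_column_nonzero)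
  hence two: "dct_weight_mat n * ?D = 1\<^sub>m n"
    by (rule mat_mult_left_right_inverse[OF _ Wc, rotated]) auto
  have "dct_weight_mat n \<in> Units (ring_mat TYPE(complex) n ())"
    unfolding Units_def using one two Wc by (auto simp: ring_mat_def intro!: bexI[of _ ?D])
  then obtain B where B: "mat_inverse (dct_weight_mat n) = Some B"
    using mat_inverse(1)[OF Wc, where b = "()"] by (cases "mat_inverse (dct_weight_mat n)") auto
  from mat_inverse(2)[OF Wc B] have "dct_weight_mat n * B = 1\<^sub>m n" "B \<in> carrier_mat n n" by auto
  moreover have "?D * dct_weight_mat n * B = ?D * (dct_weight_mat n * B)"
    by (rule assoc_mult_mat[OF mat_diag_dim Wc]) fact
  ultimately have "B = ?D"
    using one right_mult_one_mat[OF mat_diag_dim[of n "\<lambda>j. inverse (complex_of_real (dct_entry n j 0))"]]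
    by simp
  thus ?thesis using B by simp
qed

lemma upshift_mat_carrier [simp]: "upshift_mat n \<in> carrier_mat n n"
  by (simp add: upshift_mat_def)

lemma transform_mat_carrier [simp]: "transform_mat n \<in> carrier_mat n n"
  unfolding transform_mat_def dct_weight_inverse
  by (intro mult_carrier_mat[where n = n] add_carrier_mat) auto

text \<open>
  Adding the columns \<open>l\<close> and \<open>l - 1\<close> of the cosine matrix adds cosines whose arguments lie symmetrically about \<open>jl\<pi>/n\<close>;
  the common factor that appears is the entry in the first column, which the weights divide out.
  What remains is a Chebyshev matrix: the entries are \<open>(2 - \<delta>\<^sub>l\<^sub>0) cos (jl\<pi>/n)\<close>.
\<close>

lemma transform_mat_entry:
  assumes "j < n" "l < n"
  shows "transform_mat n $$ (j, l) =
    (if l = 0 then 1 else 2 * complex_of_real (cos (real j * real l * pi / real n)))"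
proof -
  let ?w = "complex_of_real (dct_entry n j 0)"
  have n: "n > 0" using assms by simp
  have w: "?w \<noteq> 0" using dct_first_column_nonzero[OF assms(1)] by simp
  have "transform_mat n $$ (j, l) = (mat_diag n (\<lambda>j. inverse (complex_of_real (dct_entry n j 0))) *
     (dct_mat n * (1\<^sub>m n + upshift_mat n))) $$ (j, l)"
    unfolding transform_mat_def dct_weight_inverse
    by (subst assoc_mult_mat[of _ n n _ n _ n]) auto
  also have "\<dots> = inverse ?w * (dct_mat n * (1\<^sub>m n + upshift_mat n)) $$ (j, l)"
    using assms by (subst mat_diag_mult_left[of _ n n])
      (auto intro!: mult_carrier_mat[of _ n n])
  also have "dct_mat n * (1\<^sub>m n + upshift_mat n) = dct_mat n + dct_mat n * upshift_mat n"
    using mult_add_distrib_mat[OF dct_mat_carrier one_carrier_mat upshift_mat_carrier]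
      right_mult_one_mat[OF dct_mat_carrier] by simp
  also have "(dct_mat n + dct_mat n * upshift_mat n) $$ (j, l)
     = dct_mat n $$ (j, l) + (\<Sum>k<n. dct_mat n $$ (j, k) * (if l = k + 1 then 1 else 0))"
    using assms carrier_matD[OF dct_mat_carrier[of n]] carrier_matD[OF upshift_mat_carrier[of n]]
    by (simp add: scalar_prod_def atLeast0LessThan) (simp add: upshift_mat_def)
  also have "(\<Sum>k<n. dct_mat n $$ (j, k) * (if l = k + 1 then 1 else 0)) =
     (if l = 0 then 0 else dct_mat n $$ (j, l - 1))"
  proof (cases l)
    case (Suc l')
    have "(\<Sum>k<n. dct_mat n $$ (j, k) * (if l = k + 1 then 1 else 0)) = (\<Sum>k<n. if k = l' then dct_mat n $$ (j, k) else 0)"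
      by (rule sum.cong) (auto simp: Suc)
    thus ?thesis using assms Suc by simp
  qed simp
  finally have *: "transform_mat n $$ (j, l) = inverse ?w * (dct_mat n $$ (j, l) +
     (if l = 0 then 0 else dct_mat n $$ (j, l - 1)))" .
  show ?thesis
  proof (cases "l = 0")
    case True
    thus ?thesis using * assms w n by (simp add: dct_mat_entry)
  next
    case False
    define c where "c = sqrt ((if j = 0 then 1 else 2) / real n)"
    have a: "real j * (2 * real l + 1) * pi / (2 * real n)
        = real j * real l * pi / real n + real j * pi / (2 * real n)"
      using n by (simp add: field_simps)
    have b: "real j * (2 * real (l - 1) + 1) * pi / (2 * real n)
        = real j * real l * pi / real n - real j * pi / (2 * real n)"
      using n False by (simp add: field_simps of_nat_diff)
    have d: "dct_entry n j 0 = c * cos (real j * pi / (2 * real n))"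
      by (simp add: dct_entry_def c_def)
    have "dct_entry n j l + dct_entry n j (l - 1)
        = 2 * cos (real j * real l * pi / real n) * dct_entry n j 0"
      unfolding d unfolding dct_entry_def a b c_def[symmetric] cos_add cos_diff by (simp add: algebra_simps)
    hence "complex_of_real (dct_entry n j l) + complex_of_real (dct_entry n j (l - 1)) =
       2 * complex_of_real (cos (real j * real l * pi / real n)) * ?w"
      by (metis of_real_add of_real_mult of_real_numeral)
    thus ?thesis using * assms w False by (simp add: dct_mat_entry field_simps)
  qed
qed

text \<open>
  Each of the three factors is invertible: a diagonal matrix with nonzero entries, an orthogonal
  matrix, and a unitriangular one.
\<close>

lemma transform_mat_inverse:
  obtains P where "P \<in> carrier_mat n n" "P * transform_mat n = 1\<^sub>m n" "transform_mat n * P = 1\<^sub>m n"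
proof -
  let ?D = "mat_diag n (\<lambda>j. inverse (complex_of_real (dct_entry n j 0)))"
  let ?E = "mat_diag n (\<lambda>j. complex_of_real (dct_entry n j 0))"
  have Z: "det (1\<^sub>m n + upshift_mat n :: complex mat) = 1"
  proof (subst det_upper_triangular[of _ n])
    have "diag_mat (1\<^sub>m n + upshift_mat n :: complex mat) = replicate n 1"
      by (rule nth_equalityI) (auto simp: diag_mat_def upshift_mat_def)
    thus "prod_list (diag_mat (1\<^sub>m n + upshift_mat n :: complex mat)) = 1" by simp
  qed (auto simp: upper_triangular_def upshift_mat_def)
  have "?E * ?D = 1\<^sub>m n"
    unfolding mat_diag_diag mat_diag_one[symmetric]
    unfolding mat_diag_def by (intro cong_mat) (auto simp: dct_first_column_nonzero)
  hence "det ?E * det ?D = 1" by (metis det_mult det_one mat_diag_dim)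
  hence D: "det ?D \<noteq> 0" by auto
  have "det (dct_mat n) * det (transpose_mat (dct_mat n)) = 1"
    by (metis det_mult det_one dct_mat_carrier dct_mat_orthogonal(1) transpose_carrier_mat)
  hence C: "det (dct_mat n) \<noteq> 0" by auto
  have "det (transform_mat n) \<noteq> 0"
    unfolding transform_mat_def dct_weight_inverse
    using Z D C by (subst det_mult[of _ n], auto simp: add_carrier_mat intro!: mult_carrier_mat[of _ n n])
        (subst (asm) det_mult[of _ n], auto)
  hence "transform_mat n \<in> Units (ring_mat TYPE(complex) n ())"
    by (intro det_non_zero_imp_unit) auto
  thus ?thesis using that by (auto simp: Units_def ring_mat_def)
qed

lemma tensors_dims:
  assumes "A \<in> tensors n1 n2 n3"
  shows "length A = n3"
    and "n3 > 0 \<Longrightarrow> tensor_rows A = n1"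
    and "n3 > 0 \<Longrightarrow> tensor_cols A = n2"
    and "i < n3 \<Longrightarrow> A ! i \<in> carrier_mat n1 n2"
  using assms by (auto simp: tensors_def tensor_rows_def tensor_cols_def)

lemma cosine_transform_slice:
  assumes "A \<in> tensors n1 n2 n3" "k < n3"
  shows "cosine_transform A ! k =
    mat n1 n2 (\<lambda>(i, j). \<Sum>l<n3. transform_mat n3 $$ (k, l) * A ! l $$ (i, j))"
  using assms tensors_dims[OF assms(1)] by (simp add: cosine_transform_def)

lemma cosine_transform_tensors:
  assumes "A \<in> tensors n1 n2 n3"
  shows "cosine_transform A \<in> tensors n1 n2 n3"
  using assms tensors_dims(1)[OF assms] cosine_transform_slice[OF assms]
  by (simp add: tensors_def) (simp add: cosine_transform_def)

lemma cosine_transform_slice_carrier: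
  assumes "A \<in> tensors n1 n2 n3" "k < n3"
  shows "cosine_transform A ! k \<in> carrier_mat n1 n2"
  using tensors_dims(4)[OF cosine_transform_tensors[OF assms(1)] assms(2)] .

text \<open>
  Injectivity of the transform: each slice is a combination of the transformed slices with
  coefficients from the inverse of the transform matrix.
\<close>

lemma cosine_transform_eqD:
  assumes A: "A \<in> tensors n1 n2 n3" and B: "B \<in> tensors n1 n2 n3"
    and eq: "\<And>k. k < n3 \<Longrightarrow> cosine_transform A ! k = cosine_transform B ! k"
  shows "A = B"
proof (rule nth_equalityI)
  show "length A = length B" using tensors_dims(1)[OF A] tensors_dims(1)[OF B] by simp
  fix p assume "p < length A"
  hence p: "p < n3" using tensors_dims(1)[OF A] by simp
  obtain P where P: "P \<in> carrier_mat n3 n3" "P * transform_mat n3 = 1\<^sub>m n3"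
    using transform_mat_inverse by metis
  have rec: "C ! p $$ (i, j) = (\<Sum>k<n3. P $$ (p, k) * cosine_transform C ! k $$ (i, j))"
    if C: "C \<in> tensors n1 n2 n3" and ij: "i < n1" "j < n2" for C i j
  proof -
    have PM: "(\<Sum>k<n3. P $$ (p, k) * transform_mat n3 $$ (k, l)) = (if p = l then 1 else 0)"
      if "l < n3" for l
    proof -
      have "(P * transform_mat n3) $$ (p, l) = (\<Sum>k<n3. P $$ (p, k) * transform_mat n3 $$ (k, l))"
        using p that carrier_matD[OF P(1)] carrier_matD[OF transform_mat_carrier[of n3]]
        by (simp add: scalar_prod_def atLeast0LessThan)
      thus ?thesis using p that by (simp add: P(2))
    qed
    have "(\<Sum>k<n3. P $$ (p, k) * cosine_transform C ! k $$ (i, j))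
        = (\<Sum>k<n3. \<Sum>l<n3. P $$ (p, k) * transform_mat n3 $$ (k, l) * C ! l $$ (i, j))"
      by (rule sum.cong) (use ij in \<open>simp_all add: cosine_transform_slice[OF C] sum_distrib_left mult.assoc\<close>)
    also have "\<dots> = (\<Sum>l<n3. (\<Sum>k<n3. P $$ (p, k) * transform_mat n3 $$ (k, l)) * C ! l $$ (i, j))"
      by (subst sum.swap) (simp add: sum_distrib_right)
    also have "\<dots> = (\<Sum>l<n3. if p = l then C ! l $$ (i, j) else 0)"
      by (rule sum.cong) (simp_all add: PM)
    also have "\<dots> = C ! p $$ (i, j)" using p by simp
    finally show ?thesis by simp
  qed
  show "A ! p = B ! p"
  proof (rule eq_matI)
    fix i j assume "i < dim_row (B ! p)" "j < dim_col (B ! p)"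
    hence ij: "i < n1" "j < n2" using tensors_dims(4)[OF B p] by auto
    show "A ! p $$ (i, j) = B ! p $$ (i, j)"
      unfolding rec[OF A ij] rec[OF B ij] using eq by simp
  qed (use tensors_dims(4)[OF A p] tensors_dims(4)[OF B p] in auto)
qed

lemma cosine_transform_surj:
  assumes F: "\<And>k. k < n3 \<Longrightarrow> F k \<in> carrier_mat n1 n2"
  shows "\<exists>C \<in> tensors n1 n2 n3. \<forall>k<n3. cosine_transform C ! k = F k"
proof -
  obtain P where P: "P \<in> carrier_mat n3 n3" "transform_mat n3 * P = 1\<^sub>m n3"
    using transform_mat_inverse by metis
  define C where "C = map (\<lambda>p. mat n1 n2 (\<lambda>(i, j). \<Sum>k<n3. P $$ (p, k) * F k $$ (i, j))) [0..<n3]"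
  have C: "C \<in> tensors n1 n2 n3" by (simp add: tensors_def C_def)
  have "cosine_transform C ! q = F q" if q: "q < n3" for q
  proof (rule eq_matI)
    fix i j assume "i < dim_row (F q)" "j < dim_col (F q)"
    hence ij: "i < n1" "j < n2" using F[OF q] by auto
    have PM: "(\<Sum>l<n3. transform_mat n3 $$ (q, l) * P $$ (l, k)) = (if q = k then 1 else 0)"
      if "k < n3" for k
    proof -
      have "(transform_mat n3 * P) $$ (q, k) = (\<Sum>l<n3. transform_mat n3 $$ (q, l) * P $$ (l, k))"
        using q that carrier_matD[OF P(1)] carrier_matD[OF transform_mat_carrier[of n3]]
        by (simp add: scalar_prod_def atLeast0LessThan)
      thus ?thesis using q that by (simp add: P(2))
    qed
    have "cosine_transform C ! q $$ (i, j) = (\<Sum>l<n3. transform_mat n3 $$ (q, l) * C ! l $$ (i, j))"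
      using ij by (simp add: cosine_transform_slice[OF C q])
    also have "\<dots> = (\<Sum>l<n3. \<Sum>k<n3. transform_mat n3 $$ (q, l) * P $$ (l, k) * F k $$ (i, j))"
      by (rule sum.cong) (use ij in \<open>simp_all add: C_def sum_distrib_left mult.assoc\<close>)
    also have "\<dots> = (\<Sum>k<n3. (\<Sum>l<n3. transform_mat n3 $$ (q, l) * P $$ (l, k)) * F k $$ (i, j))"
      by (subst sum.swap) (simp add: sum_distrib_right)
    also have "\<dots> = (\<Sum>k<n3. if q = k then F k $$ (i, j) else 0)"
      by (rule sum.cong) (simp_all add: PM)
    also have "\<dots> = F q $$ (i, j)" using q by simp
    finally show "cosine_transform C ! q $$ (i, j) = F q $$ (i, j)" .
  qed (use F[OF q] cosine_transform_slice_carrier[OF C q] in auto)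
  thus ?thesis using C by blast
qed

text \<open>
  All tensor operations are specified by their transformed slices; this lemma turns such a
  specification into the two facts used about them.
\<close>

lemma the_tensor_with_slices:
  assumes F: "\<And>k. k < n3 \<Longrightarrow> F k \<in> carrier_mat n1 n2"
    and T: "T = (THE C. C \<in> tensors n1 n2 n3 \<and> (\<forall>k<n3. cosine_transform C ! k = F k))"
  shows "T \<in> tensors n1 n2 n3" "k < n3 \<Longrightarrow> cosine_transform T ! k = F k"
proof -
  obtain C where C: "C \<in> tensors n1 n2 n3" "\<And>k. k < n3 \<Longrightarrow> cosine_transform C ! k = F k"
    using cosine_transform_surj[of n3 F n1 n2] F by blast
  have "T = C" unfolding T
  proof (rule the_equality)
    fix C' assume *: "C' \<in> tensors n1 n2 n3 \<and> (\<forall>k<n3. cosine_transform C' ! k = F k)"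
    show "C' = C" by (rule cosine_transform_eqD[of _ n1 n2 n3]) (use * C in simp_all)
  qed (use C in simp)
  thus "T \<in> tensors n1 n2 n3" "k < n3 \<Longrightarrow> cosine_transform T ! k = F k" using C by auto
qed

section \<open>The tensor algebra as a product of matrix algebras\<close>

lemma c_product_slices:
  assumes "n3 > 0" and A: "A \<in> tensors n1 n2 n3" and B: "B \<in> tensors n2 n4 n3"
  shows "A *\<^sub>c B \<in> tensors n1 n4 n3"
    and "k < n3 \<Longrightarrow> cosine_transform (A *\<^sub>c B) ! k = cosine_transform A ! k * cosine_transform B ! k"
proof -
  let ?F = "\<lambda>k. cosine_transform A ! k * cosine_transform B ! k"
  have F: "?F k \<in> carrier_mat n1 n4" if "k < n3" for k
    using mult_carrier_mat[OF cosine_transform_slice_carrier[OF A that] cosine_transform_slice_carrier[OF B that]] .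
  have T: "A *\<^sub>c B = (THE C. C \<in> tensors n1 n4 n3 \<and> (\<forall>k<n3. cosine_transform C ! k = ?F k))"
    unfolding c_product_def using assms tensors_dims[OF A] tensors_dims[OF B] by simp
  show "A *\<^sub>c B \<in> tensors n1 n4 n3" "k < n3 \<Longrightarrow> cosine_transform (A *\<^sub>c B) ! k = ?F k"
    by (rule the_tensor_with_slices[OF F T], assumption)+
qed

lemma conj_transpose_tensors:
  assumes "n3 > 0" and A: "A \<in> tensors n1 n2 n3"
  shows "A\<^sup>H \<in> tensors n2 n1 n3"
proof (rule the_tensor_with_slices(1))
  show "A\<^sup>H = (THE C. C \<in> tensors n2 n1 n3 \<and>
     (\<forall>k<n3. cosine_transform C ! k = mat_adjoint (cosine_transform A ! k)))"
    unfolding conj_transpose_def using assms tensors_dims[OF A] by simp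
  show "mat_adjoint (cosine_transform A ! k) \<in> carrier_mat n2 n1" if "k < n3" for k
    using cosine_transform_slice_carrier[OF A that] by (auto simp: mat_adjoint_def mat_of_rows_def)
qed

lemma id_tensor_slices:
  "id_tensor n n3 \<in> tensors n n n3" "k < n3 \<Longrightarrow> cosine_transform (id_tensor n n3) ! k = 1\<^sub>m n"
proof -
  show "id_tensor n n3 \<in> tensors n n n3"
    by (rule the_tensor_with_slices(1)[OF one_carrier_mat id_tensor_def])
  show "k < n3 \<Longrightarrow> cosine_transform (id_tensor n n3) ! k = 1\<^sub>m n"
    by (rule the_tensor_with_slices(2)[OF one_carrier_mat id_tensor_def])
qed

lemma zero_tensor_slices:
  shows "zero_tensor n1 n2 n3 \<in> tensors n1 n2 n3"
    and "k < n3 \<Longrightarrow> cosine_transform (zero_tensor n1 n2 n3) ! k = 0\<^sub>m n1 n2"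
proof -
  show *: "zero_tensor n1 n2 n3 \<in> tensors n1 n2 n3" by (simp add: tensors_def zero_tensor_def)
  assume k: "k < n3"
  show "cosine_transform (zero_tensor n1 n2 n3) ! k = 0\<^sub>m n1 n2"
    unfolding cosine_transform_slice[OF * k] by (rule eq_matI) (auto simp: zero_tensor_def)
qed

text \<open>
  The transform acts on each position \<open>(i, j)\<close> of the slices separately, so it commutes with the
  partition into blocks.
\<close>

lemma block_tensor_slices:
  assumes A: "A \<in> tensors r s n3" and B: "B \<in> tensors r t n3"
    and C: "C \<in> tensors u s n3" and D: "D \<in> tensors u t n3"
  shows "block_tensor A B C D \<in> tensors (r + u) (s + t) n3"
    and "k < n3 \<Longrightarrow> cosine_transform (block_tensor A B C D) ! k =
      four_block_mat (cosine_transform A ! k) (cosine_transform B ! k)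
        (cosine_transform C ! k) (cosine_transform D ! k)"
proof -
  show *: "block_tensor A B C D \<in> tensors (r + u) (s + t) n3"
    using A B C D by (auto simp: tensors_def block_tensor_def)
  assume k: "k < n3"
  note sl = cosine_transform_slice[OF A k] cosine_transform_slice[OF B k]
    cosine_transform_slice[OF C k] cosine_transform_slice[OF D k]
  note dims = tensors_dims(4)[OF A] tensors_dims(4)[OF B] tensors_dims(4)[OF C] tensors_dims(4)[OF D]
  show "cosine_transform (block_tensor A B C D) ! k =
      four_block_mat (cosine_transform A ! k) (cosine_transform B ! k)
        (cosine_transform C ! k) (cosine_transform D ! k)"
    unfolding cosine_transform_slice[OF * k] sl
  proof (rule eq_matI, goal_cases)
    case (1 i j)
    have *: "block_tensor A B C D ! l $$ (i, j) =
      (if i < r then if j < s then A ! l $$ (i, j) else B ! l $$ (i, j - s)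
       else if j < s then C ! l $$ (i - r, j) else D ! l $$ (i - r, j - s))" if "l < n3" for l
      using that dims[OF that] 1 tensors_dims(1)[OF A]
      by (auto simp: block_tensor_def)
    have "(\<Sum>l<n3. transform_mat n3 $$ (k, l) * block_tensor A B C D ! l $$ (i, j)) =
      (\<Sum>l<n3. transform_mat n3 $$ (k, l) * (if i < r then if j < s then A ! l $$ (i, j) else B ! l $$ (i, j - s)
       else if j < s then C ! l $$ (i - r, j) else D ! l $$ (i - r, j - s)))"
      by (rule sum.cong) (simp_all add: *)
    thus ?case using 1 by auto
  qed auto
qed

definition tensor_monoid :: "nat \<Rightarrow> nat \<Rightarrow> tensor monoid" where
  "tensor_monoid n n3 = \<lparr>carrier = tensors n n n3, monoid.mult = c_product, one = id_tensor n n3\<rparr>"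

lemma tensor_monoid_simps [simp]:
  "carrier (tensor_monoid n n3) = tensors n n n3"
  "monoid.mult (tensor_monoid n n3) = c_product"
  "monoid.one (tensor_monoid n n3) = id_tensor n n3"
  by (simp_all add: tensor_monoid_def)

lemma c_product_assoc:
  assumes "n3 > 0" and A: "A \<in> tensors n1 n2 n3" and B: "B \<in> tensors n2 n4 n3" and C: "C \<in> tensors n4 n5 n3"
  shows "A *\<^sub>c B *\<^sub>c C = A *\<^sub>c (B *\<^sub>c C)"
proof (rule cosine_transform_eqD)
  note pr = c_product_slices[OF assms(1)]
  show "A *\<^sub>c B *\<^sub>c C \<in> tensors n1 n5 n3" "A *\<^sub>c (B *\<^sub>c C) \<in> tensors n1 n5 n3"
    using pr(1)[OF pr(1)[OF A B] C] pr(1)[OF A pr(1)[OF B C]] .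
  fix k assume k: "k < n3"
  show "cosine_transform (A *\<^sub>c B *\<^sub>c C) ! k = cosine_transform (A *\<^sub>c (B *\<^sub>c C)) ! k"
    unfolding pr(2)[OF pr(1)[OF A B] C k] pr(2)[OF A B k] pr(2)[OF A pr(1)[OF B C] k] pr(2)[OF B C k]
    by (rule assoc_mult_mat) (use cosine_transform_slice_carrier[OF _ k] A B C in blast)+
qed

lemma monoid_tensors:
  assumes "n3 > 0"
  shows "monoid (tensor_monoid n n3)"
proof
  note pr = c_product_slices[OF assms]
  fix A assume "A \<in> carrier (tensor_monoid n n3)"
  hence A: "A \<in> tensors n n n3" by simp
  note A' = cosine_transform_slice_carrier[OF A]
  have "id_tensor n n3 *\<^sub>c A = A"
    by (rule cosine_transform_eqD[OF pr(1)[OF id_tensor_slices(1) A] A])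
       (simp add: pr(2)[OF id_tensor_slices(1) A] id_tensor_slices(2) left_mult_one_mat[OF A'])
  thus "\<one>\<^bsub>tensor_monoid n n3\<^esub> \<otimes>\<^bsub>tensor_monoid n n3\<^esub> A = A" by simp
  have "A *\<^sub>c id_tensor n n3 = A"
    by (rule cosine_transform_eqD[OF pr(1)[OF A id_tensor_slices(1)] A])
       (simp add: pr(2)[OF A id_tensor_slices(1)] id_tensor_slices(2) right_mult_one_mat[OF A'])
  thus "A \<otimes>\<^bsub>tensor_monoid n n3\<^esub> \<one>\<^bsub>tensor_monoid n n3\<^esub> = A" by simp
qed (simp_all add: id_tensor_slices(1) c_product_slices(1)[OF assms, of _ n n _ n] c_product_assoc[OF assms, of _ n n _ n _ n])

lemma tensor_pow_monoid:
  assumes "n3 > 0" and A: "A \<in> tensors n n n3"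
  shows "A ^\<^sub>c k = A [^]\<^bsub>tensor_monoid n n3\<^esub> k"
proof (induction k)
  interpret monoid "tensor_monoid n n3" by (rule monoid_tensors[OF assms(1)])
  case 0 thus ?case using tensors_dims[OF A] assms(1) by (simp add: nat_pow_def)
next
  interpret monoid "tensor_monoid n n3" by (rule monoid_tensors[OF assms(1)])
  case (Suc k) thus ?case by simp
qed

lemma tensor_pow_slices:
  assumes "n3 > 0" and A: "A \<in> tensors n n n3"
  shows "A ^\<^sub>c m \<in> tensors n n n3"
    and "k < n3 \<Longrightarrow> cosine_transform (A ^\<^sub>c m) ! k = (cosine_transform A ! k) ^\<^sub>m m"
proof -
  have *: "A ^\<^sub>c m \<in> tensors n n n3 \<and> (k < n3 \<longrightarrow> cosine_transform (A ^\<^sub>c m) ! k = (cosine_transform A ! k) ^\<^sub>m m)" for k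
  proof (induction m)
    case 0
    show ?case using tensors_dims[OF A] assms(1) id_tensor_slices[of n n3] id_tensor_slices(2)[of k n3 n]
      carrier_matD[OF cosine_transform_slice_carrier[OF A]] by simp
  next
    case (Suc m)
    thus ?case using c_product_slices[OF assms(1) _ A, of "A ^\<^sub>c m" n] by auto
  qed
  from * show "A ^\<^sub>c m \<in> tensors n n n3" by blast
  from * show "k < n3 \<Longrightarrow> cosine_transform (A ^\<^sub>c m) ! k = (cosine_transform A ! k) ^\<^sub>m m" by blast
qed

section \<open>Diagonalisation of the Toeplitz-plus-Hankel matrix\<close>

text \<open>
  For one fixed position in the frontal slices, the sequence \<open>g\<close> of entries along the third mode
  contributes this number to block \<open>(p, q)\<close> of the Toeplitz-plus-Hankel matrix.
\<close>

definition block_coeff :: "nat \<Rightarrow> (nat \<Rightarrow> complex) \<Rightarrow> nat \<Rightarrow> nat \<Rightarrow> complex" where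
  "block_coeff n g p q = g (if p \<le> q then q - p else p - q) +
     (if p + q + 2 \<le> n then g (p + q + 1)
      else if p + q + 2 = n + 1 then 0 else g (2 * n - 1 - p - q))"

text \<open>
  Extend the cosines \<open>f(p) = cos (j(2p + 1)\<pi>/2n)\<close> to all integers \<open>p\<close>. They are symmetric about
  \<open>- 1/2\<close> and about \<open>n - 1/2\<close>, and the Hankel part of the matrix is precisely what these two
  reflections produce: applied to the \<open>l\<close>-th unit sequence with \<open>l \<ge> 1\<close>, column \<open>q\<close> of the matrix
  evaluates \<open>f\<close> at \<open>q - l\<close> and at \<open>q + l\<close>, reflected into the range \<open>0, \<dots>, n - 1\<close>. The product
  formula gives \<open>f(q - l) + f(q + l) = 2 cos (jl\<pi>/n) f(q)\<close>, and the factor in front of \<open>f(q)\<close> is the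
  entry of the transform matrix. For \<open>l = 0\<close> the matrix is the identity.
\<close>

lemma dct_left_eigenvector:
  assumes j: "j < n" and q: "q < n"
  shows "(\<Sum>p<n. complex_of_real (dct_entry n j p) * block_coeff n g p q)
    = (\<Sum>l<n. transform_mat n $$ (j, l) * g l) * complex_of_real (dct_entry n j q)"
proof -
  let ?c = "\<lambda>p. complex_of_real (dct_entry n j p)"
  have n: "n > 0" using q by simp
  \<comment> \<open>The coefficient of \<open>g l\<close> in block \<open>(p, q)\<close>.\<close>
  define hit :: "nat \<Rightarrow> nat \<Rightarrow> complex" where
    "hit = (\<lambda>p l. (if l = (if p \<le> q then q - p else p - q) then 1 else 0) +
       (if l = p + q + 1 then 1 else 0) + (if n \<le> p + q \<and> l = 2 * n - 1 - p - q then 1 else 0))"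
  have expand: "block_coeff n g p q = (\<Sum>l<n. hit p l * g l)" if p: "p < n" for p
  proof -
    have single: "(\<Sum>l<n. (if P \<and> l = m then 1 else 0) * g l) = (if P \<and> m < n then g m else 0)" for P m
    proof -
      have "(\<Sum>l<n. (if P \<and> l = m then 1 else 0) * g l) = (\<Sum>l<n. if l = m then (if P then g l else 0) else 0)"
        by (rule sum.cong) auto
      thus ?thesis by simp
    qed
    let ?d = "if p \<le> q then q - p else p - q"
    have "(\<Sum>l<n. hit p l * g l) = (if ?d < n then g ?d else 0) + (if p + q + 1 < n then g (p + q + 1) else 0)
        + (if n \<le> p + q \<and> 2 * n - 1 - p - q < n then g (2 * n - 1 - p - q) else 0)"
      using single[of True ?d] single[of True "p + q + 1"] single[of "n \<le> p + q" "2 * n - 1 - p - q"]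
      by (simp only: hit_def distrib_right sum.distrib simp_thms)
    moreover have "?d < n" using p q by auto
    moreover have "n \<le> p + q \<Longrightarrow> 2 * n - 1 - p - q < n" using p q by auto
    ultimately show ?thesis unfolding block_coeff_def by auto
  qed
  have column: "(\<Sum>p<n. ?c p * hit p l) = transform_mat n $$ (j, l) * ?c q" if l: "l < n" for l
  proof (cases "l = 0")
    case True
    have "(\<Sum>p<n. ?c p * hit p l) = (\<Sum>p<n. if p = q then ?c p else 0)"
      by (rule sum.cong) (use q in \<open>auto simp: hit_def True\<close>)
    thus ?thesis using j n q by (simp add: True transform_mat_entry)
  next
    case False
    \<comment> \<open>The points \<open>q - l\<close> and \<open>q + l\<close>, reflected about \<open>- 1/2\<close> and \<open>n - 1/2\<close> if they
      lie outside the range of indices.\<close>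
    define lo where "lo = (if l \<le> q then q - l else l - 1 - q)"
    define hi where "hi = (if q + l < n then q + l else 2 * n - 1 - q - l)"
    have lohi: "lo < n" "hi < n" using q l by (auto simp: lo_def hi_def)
    have hit: "hit p l = (if p = lo then 1 else 0) + (if p = hi then 1 else 0)" if p: "p < n" for p
    proof -
      have 1: "p = lo \<longleftrightarrow> (p \<le> q \<and> l = q - p) \<or> l = p + q + 1"
        using p q l False by (auto simp: lo_def)
      have 2: "p = hi \<longleftrightarrow> (\<not> p \<le> q \<and> l = p - q) \<or> (n \<le> p + q \<and> l = 2 * n - 1 - p - q)"
        using p q l False by (auto simp: hi_def)
      show ?thesis unfolding 1 2 using p q l False by (auto simp: hit_def)
    qed
    have "(\<Sum>p<n. ?c p * hit p l) = (\<Sum>p<n. (if p = lo then ?c p else 0) + (if p = hi then ?c p else 0))"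
      by (rule sum.cong) (auto simp: hit)
    hence sum: "(\<Sum>p<n. ?c p * hit p l) = ?c lo + ?c hi"
      using lohi by (simp add: sum.distrib)
    define s where "s = sqrt ((if j = 0 then 1 else 2) / real n)"
    define a where "a = real j * (2 * real q + 1) * pi / (2 * real n)"
    define b where "b = real j * real l * pi / real n"
    have "dct_entry n j lo = s * cos (a - b)"
    proof (cases "l \<le> q")
      case True
      have "real j * (2 * real lo + 1) * pi / (2 * real n) = a - b"
        using True n by (simp add: lo_def a_def b_def of_nat_diff field_simps)
      thus ?thesis by (simp add: dct_entry_def s_def)
    next
      case False
      hence lo: "real lo = real l - 1 - real q" by (simp add: lo_def of_nat_diff)
      have "real j * (2 * real lo + 1) * pi / (2 * real n) = - (a - b)"
        unfolding lo using n by (simp add: a_def b_def field_simps)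
      hence "dct_entry n j lo = s * cos (- (a - b))" by (simp only: dct_entry_def s_def)
      thus ?thesis by (simp only: cos_minus)
    qed
    moreover have "dct_entry n j hi = s * cos (a + b)"
    proof (cases "q + l < n")
      case True
      have "real j * (2 * real hi + 1) * pi / (2 * real n) = a + b"
        using True n by (simp add: hi_def a_def b_def field_simps)
      thus ?thesis by (simp add: dct_entry_def s_def)
    next
      case False
      hence hi: "real hi = 2 * real n - 1 - real q - real l" using q l by (simp add: hi_def of_nat_diff)
      have "real j * (2 * real hi + 1) * pi / (2 * real n) = 2 * real j * pi - (a + b)"
        unfolding hi using n by (simp add: a_def b_def field_simps)
      moreover have "cos (2 * real j * pi - (a + b)) = cos (a + b)"
        using cos_int_2pin[of "int j"] sin_int_2pin[of "int j"]
        by (simp add: cos_diff mult.commute mult.left_commute)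
      ultimately show ?thesis by (simp add: dct_entry_def s_def)
    qed
    ultimately have "dct_entry n j lo + dct_entry n j hi = 2 * cos b * dct_entry n j q"
      by (simp add: cos_add cos_diff dct_entry_def s_def a_def algebra_simps)
    hence "?c lo + ?c hi = 2 * complex_of_real (cos b) * ?c q"
      by (metis of_real_add of_real_mult of_real_numeral)
    thus ?thesis using sum j l False by (simp add: transform_mat_entry b_def)
  qed
  have "(\<Sum>p<n. ?c p * block_coeff n g p q) = (\<Sum>p<n. \<Sum>l<n. ?c p * hit p l * g l)"
    by (rule sum.cong) (simp_all add: expand sum_distrib_left mult.assoc)
  also have "\<dots> = (\<Sum>l<n. (\<Sum>p<n. ?c p * hit p l) * g l)"
    by (subst sum.swap) (simp add: sum_distrib_right)
  also have "\<dots> = (\<Sum>l<n. transform_mat n $$ (j, l) * g l) * ?c q"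
    unfolding sum_distrib_right
  proof (rule sum.cong[OF refl])
    fix l assume "l \<in> {..<n}"
    hence "(\<Sum>p<n. ?c p * hit p l) * g l = transform_mat n $$ (j, l) * ?c q * g l"
      by (simp only: column lessThan_iff)
    thus "(\<Sum>p<n. ?c p * hit p l * g l) = transform_mat n $$ (j, l) * g l * ?c q"
      by (simp only: sum_distrib_right mult.assoc mult.commute[of "g l"])
  qed
  finally show ?thesis .
qed

text \<open>
  The eigenvector equations for all \<open>j\<close>, combined with the orthonormality of the columns of the
  cosine matrix.
\<close>

lemma block_coeff_spectral:
  assumes "p < n" "q < n"
  shows "block_coeff n g p q = (\<Sum>j<n. complex_of_real (dct_entry n j p) *
    complex_of_real (dct_entry n j q) * (\<Sum>l<n. transform_mat n $$ (j, l) * g l))"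
proof -
  let ?c = "\<lambda>j p. complex_of_real (dct_entry n j p)"
  have "(\<Sum>j<n. ?c j p * ?c j q * (\<Sum>l<n. transform_mat n $$ (j, l) * g l))
      = (\<Sum>j<n. \<Sum>p'<n. ?c j p * ?c j p' * block_coeff n g p' q)"
  proof (rule sum.cong)
    fix j assume "j \<in> {..<n}"
    hence j: "j < n" by simp
    have "?c j p * ?c j q * (\<Sum>l<n. transform_mat n $$ (j, l) * g l) =
      ?c j p * ((\<Sum>l<n. transform_mat n $$ (j, l) * g l) * ?c j q)" by (simp add: mult_ac)
    thus "?c j p * ?c j q * (\<Sum>l<n. transform_mat n $$ (j, l) * g l)
      = (\<Sum>p'<n. ?c j p * ?c j p' * block_coeff n g p' q)"
      by (simp only: dct_left_eigenvector[OF j assms(2), symmetric] sum_distrib_left mult.assoc)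
  qed simp
  also have "\<dots> = (\<Sum>p'<n. (\<Sum>j<n. ?c j p * ?c j p') * block_coeff n g p' q)"
    by (subst sum.swap) (simp only: sum_distrib_right)
  also have "\<dots> = (\<Sum>p'<n. if p = p' then block_coeff n g p' q else 0)"
    by (rule sum.cong) (use assms in \<open>simp_all add: dct_columns_orthonormal\<close>)
  also have "\<dots> = block_coeff n g p q" using assms by simp
  finally show ?thesis by simp
qed

lemma block_index_less:
  fixes p x n t :: nat
  assumes "p < t" "x < n"
  shows "p * n + x < t * n"
proof -
  have "p * n + x < Suc p * n" using assms by simp
  also have "\<dots> \<le> t * n" using assms by (intro mult_le_mono1) simp
  finally show ?thesis .
qed

lemma tensor_mat_carrier:
  assumes "t > 0" "A \<in> tensors n m t"
  shows "tensor_mat A \<in> carrier_mat (t * n) (t * m)"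
  using assms tensors_dims[OF assms(2)] by (simp add: tensor_mat_def Let_def)

text \<open>
  This is \<open>mat(A) = (C\<^sup>T \<otimes> I) diag(L(A)) (C \<otimes> I)\<close> in coordinates, with \<open>C\<close> the cosine matrix and
  \<open>diag(L(A))\<close> the block diagonal matrix of the transformed slices.
\<close>

lemma tensor_mat_spectral:
  assumes A: "A \<in> tensors n m t" and ix: "p < t" "q < t" "x < n" "y < m"
  shows "tensor_mat A $$ (p * n + x, q * m + y) = (\<Sum>j<t. complex_of_real (dct_entry t j p) *
    complex_of_real (dct_entry t j q) * cosine_transform A ! j $$ (x, y))"
proof -
  have t: "t > 0" using ix by simp
  have "tensor_mat A $$ (p * n + x, q * m + y) = (toeplitz_block A p q + hankel_block A p q) $$ (x, y)"
    using ix tensors_dims[OF A] t block_index_less[of p t x n] block_index_less[of q t y m]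
    by (simp add: tensor_mat_def Let_def)
  also have "\<dots> = block_coeff t (\<lambda>l. A ! l $$ (x, y)) p q"
  proof -
    have "hankel_block A p q \<in> carrier_mat n m"
      unfolding hankel_block_def Let_def tensors_dims(1)[OF A] tensors_dims(2,3)[OF A t]
      using ix by (auto intro!: tensors_dims(4)[OF A])
    thus ?thesis using ix tensors_dims(1,2,3)[OF A] t
      by (auto simp: toeplitz_block_def hankel_block_def Let_def block_coeff_def)
  qed
  also have "\<dots> = (\<Sum>j<t. complex_of_real (dct_entry t j p) *
    complex_of_real (dct_entry t j q) * cosine_transform A ! j $$ (x, y))"
    unfolding block_coeff_spectral[OF ix(1,2)]
    by (rule sum.cong) (use ix in \<open>simp_all add: cosine_transform_slice[OF A]\<close>)
  finally show ?thesis .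
qed

lemma eq_mat_blockwiseI:
  fixes M N :: "complex mat"
  assumes "M \<in> carrier_mat (t * n) (t * m)" "N \<in> carrier_mat (t * n) (t * m)"
    and eq: "\<And>p q x y. \<lbrakk>p < t; q < t; x < n; y < m\<rbrakk> \<Longrightarrow>
      M $$ (p * n + x, q * m + y) = N $$ (p * n + x, q * m + y)"
  shows "M = N"
proof (rule eq_matI)
  fix a b assume "a < dim_row N" "b < dim_col N"
  hence ab: "a < t * n" "b < t * m" using assms(2) by auto
  hence nm: "n > 0" "m > 0" by (auto intro: Nat.gr0I)
  have "a div n < t" "b div m < t" using ab by (simp_all add: less_mult_imp_div_less)
  from eq[OF this, of "a mod n" "b mod m"] nm show "M $$ (a, b) = N $$ (a, b)" by simp
qed (use assms in auto)

text \<open>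
  The transformed slices can be recovered from the first block column, because the first
  column of the cosine matrix has no zeros.
\<close>

lemma tensor_mat_inj:
  assumes A: "A \<in> tensors n m t" and B: "B \<in> tensors n m t"
    and t: "t > 0" and eq: "tensor_mat A = tensor_mat B"
  shows "A = B"
proof (rule cosine_transform_eqD[OF A B])
  fix i assume i: "i < t"
  let ?c = "\<lambda>j p. complex_of_real (dct_entry t j p)"
  have slice: "(\<Sum>p<t. ?c i p * tensor_mat C $$ (p * n + x, 0 * m + y)) = ?c i 0 * cosine_transform C ! i $$ (x, y)"
    if C: "C \<in> tensors n m t" and xy: "x < n" "y < m" for C x y
  proof -
    have "(\<Sum>p<t. ?c i p * tensor_mat C $$ (p * n + x, 0 * m + y))
       = (\<Sum>p<t. \<Sum>j<t. ?c i p * ?c j p * (?c j 0 * cosine_transform C ! j $$ (x, y)))"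
      by (rule sum.cong[OF refl], subst tensor_mat_spectral[OF C])
         (use t xy in \<open>simp_all add: sum_distrib_left mult.assoc\<close>)
    also have "\<dots> = (\<Sum>j<t. (\<Sum>p<t. ?c i p * ?c j p) * (?c j 0 * cosine_transform C ! j $$ (x, y)))"
      by (subst sum.swap) (simp only: sum_distrib_right)
    also have "\<dots> = (\<Sum>j<t. if i = j then ?c j 0 * cosine_transform C ! j $$ (x, y) else 0)"
      by (rule sum.cong) (use i in \<open>simp_all add: dct_rows_orthonormal flip: of_real_mult of_real_sum\<close>)
    finally show ?thesis using i by simp
  qed
  show "cosine_transform A ! i = cosine_transform B ! i"
  proof (rule eq_matI)
    fix x y assume "x < dim_row (cosine_transform B ! i)" "y < dim_col (cosine_transform B ! i)"
    hence xy: "x < n" "y < m" using cosine_transform_slice_carrier[OF B i] by auto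
    show "cosine_transform A ! i $$ (x, y) = cosine_transform B ! i $$ (x, y)"
      using slice[OF A xy] slice[OF B xy] eq dct_first_column_nonzero[OF i] by simp
  qed (use cosine_transform_slice_carrier[OF A i] cosine_transform_slice_carrier[OF B i] in auto)
qed

lemma tensor_mat_id:
  assumes "t > 0"
  shows "tensor_mat (id_tensor n t) = 1\<^sub>m (t * n)"
proof (rule eq_mat_blockwiseI)
  show "tensor_mat (id_tensor n t) \<in> carrier_mat (t * n) (t * n)"
    by (rule tensor_mat_carrier[OF assms id_tensor_slices(1)])
  fix p q x y assume ix: "p < t" "q < t" "x < n" "y < n"
  have "tensor_mat (id_tensor n t) $$ (p * n + x, q * n + y)
    = (\<Sum>j<t. complex_of_real (dct_entry t j p) * complex_of_real (dct_entry t j q)) * (if x = y then 1 else 0)"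
    unfolding tensor_mat_spectral[OF id_tensor_slices(1) ix] sum_distrib_right
    by (rule sum.cong) (use ix in \<open>simp_all add: id_tensor_slices(2)\<close>)
  moreover have "p * n + x = q * n + y \<longleftrightarrow> p = q \<and> x = y"
  proof
    assume e: "p * n + x = q * n + y"
    have "(p * n + x) div n = p" "(q * n + y) div n = q" using ix by simp_all
    thus "p = q \<and> x = y" using e by auto
  qed auto
  ultimately show "tensor_mat (id_tensor n t) $$ (p * n + x, q * n + y) = 1\<^sub>m (t * n) $$ (p * n + x, q * n + y)"
    using ix block_index_less[of p t x n] block_index_less[of q t y n]
    by (simp add: dct_columns_orthonormal)
qed simp

text \<open>
  In the product of the two spectral expansions the inner factors collapse by orthonormality
  of the rows of the cosine matrix, which leaves the products of corresponding slices.
\<close>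

lemma tensor_mat_c_product:
  assumes t: "t > 0" and A: "A \<in> tensors n1 n2 t" and B: "B \<in> tensors n2 n4 t"
  shows "tensor_mat (A *\<^sub>c B) = tensor_mat A * tensor_mat B"
proof (rule eq_mat_blockwiseI)
  note AB = c_product_slices(1)[OF t A B]
  note cA = tensor_mat_carrier[OF t A] and cB = tensor_mat_carrier[OF t B]
  show "tensor_mat (A *\<^sub>c B) \<in> carrier_mat (t * n1) (t * n4)" by (rule tensor_mat_carrier[OF t AB])
  show "tensor_mat A * tensor_mat B \<in> carrier_mat (t * n1) (t * n4)" using cA cB by simp
  fix p s x z assume ix: "p < t" "s < t" "x < n1" "z < n4"
  let ?c = "\<lambda>j p. complex_of_real (dct_entry t j p)"
  let ?A = "\<lambda>i y. cosine_transform A ! i $$ (x, y)"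
  let ?B = "\<lambda>j y. cosine_transform B ! j $$ (y, z)"
  have "(tensor_mat A * tensor_mat B) $$ (p * n1 + x, s * n4 + z)
      = (\<Sum>k<t * n2. tensor_mat A $$ (p * n1 + x, k) * tensor_mat B $$ (k, s * n4 + z))"
    using ix block_index_less[of p t x n1] block_index_less[of s t z n4] cA cB
    by (simp add: scalar_prod_def atLeast0LessThan)
  also have "\<dots> = (\<Sum>q<t. \<Sum>k = q * n2..<q * n2 + n2. tensor_mat A $$ (p * n1 + x, k) * tensor_mat B $$ (k, s * n4 + z))"
    by (rule sum.nat_group[symmetric])
  also have "\<dots> = (\<Sum>q<t. \<Sum>y<n2. tensor_mat A $$ (p * n1 + x, q * n2 + y) * tensor_mat B $$ (q * n2 + y, s * n4 + z))"
    by (rule sum.cong[OF refl])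
       (simp add: sum.atLeastLessThan_shift_0 atLeast0LessThan add.commute)
  also have "\<dots> = (\<Sum>q<t. \<Sum>y<n2. \<Sum>i<t. \<Sum>j<t. (?c i p * ?c i q * ?A i y) * (?c j q * ?c j s * ?B j y))"
    by (intro sum.cong refl) (use ix in \<open>simp add: tensor_mat_spectral[OF A] tensor_mat_spectral[OF B] sum_product\<close>)
  also have "\<dots> = (\<Sum>q<t. \<Sum>i<t. \<Sum>y<n2. \<Sum>j<t. (?c i p * ?c i q * ?A i y) * (?c j q * ?c j s * ?B j y))"
    by (rule sum.cong[OF refl], rule sum.swap)
  also have "\<dots> = (\<Sum>i<t. \<Sum>q<t. \<Sum>y<n2. \<Sum>j<t. (?c i p * ?c i q * ?A i y) * (?c j q * ?c j s * ?B j y))"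
    by (rule sum.swap)
  also have "\<dots> = (\<Sum>i<t. \<Sum>q<t. \<Sum>j<t. \<Sum>y<n2. (?c i p * ?c i q * ?A i y) * (?c j q * ?c j s * ?B j y))"
    by (rule sum.cong[OF refl], rule sum.cong[OF refl], rule sum.swap)
  also have "\<dots> = (\<Sum>i<t. \<Sum>j<t. \<Sum>q<t. \<Sum>y<n2. (?c i p * ?c i q * ?A i y) * (?c j q * ?c j s * ?B j y))"
    by (rule sum.cong[OF refl], rule sum.swap)
  also have "\<dots> = (\<Sum>i<t. \<Sum>j<t. (\<Sum>q<t. ?c i q * ?c j q) * (?c i p * ?c j s * (\<Sum>y<n2. ?A i y * ?B j y)))"
    by (intro sum.cong refl) (subst sum_distrib_left, subst sum_product, simp only: mult_ac)
  also have "\<dots> = (\<Sum>i<t. \<Sum>j<t. if i = j then ?c i p * ?c j s * (\<Sum>y<n2. ?A i y * ?B j y) else 0)"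
    by (intro sum.cong refl) (simp_all add: dct_rows_orthonormal flip: of_real_mult of_real_sum)
  also have "\<dots> = (\<Sum>i<t. ?c i p * ?c i s * (\<Sum>y<n2. ?A i y * ?B i y))"
    by (rule sum.cong) simp_all
  also have "\<dots> = (\<Sum>i<t. ?c i p * ?c i s * cosine_transform (A *\<^sub>c B) ! i $$ (x, z))"
  proof (rule sum.cong[OF refl])
    fix i assume "i \<in> {..<t}"
    hence i: "i < t" by simp
    show "?c i p * ?c i s * (\<Sum>y<n2. ?A i y * ?B i y) = ?c i p * ?c i s * cosine_transform (A *\<^sub>c B) ! i $$ (x, z)"
      using ix cosine_transform_slice_carrier[OF A i] cosine_transform_slice_carrier[OF B i]
      by (simp add: c_product_slices(2)[OF t A B i] scalar_prod_def atLeast0LessThan)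
  qed
  also have "\<dots> = tensor_mat (A *\<^sub>c B) $$ (p * n1 + x, s * n4 + z)"
    by (rule tensor_mat_spectral[OF AB ix, symmetric])
  finally show "tensor_mat (A *\<^sub>c B) $$ (p * n1 + x, s * n4 + z) = (tensor_mat A * tensor_mat B) $$ (p * n1 + x, s * n4 + z)"
    by simp
qed

lemma tensor_mat_pow:
  assumes t: "t > 0" and A: "A \<in> tensors n n t"
  shows "tensor_mat (A ^\<^sub>c k) = tensor_mat A ^\<^sub>m k"
proof (induction k)
  case 0
  show ?case using tensors_dims[OF A] t tensor_mat_id[OF t, of n] carrier_matD[OF tensor_mat_carrier[OF t A]] by simp
next
  case (Suc k)
  thus ?case using tensor_mat_c_product[OF t tensor_pow_slices(1)[OF t A] A] by simp
qed

section \<open>Drazin inverses in a monoid\<close>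

text \<open>
  The Drazin equations with an unspecified exponent. In the definition for tensors the exponent
  is the index; dropping it makes the notion purely multiplicative, hence compatible with
  conjugation, with passing to slices and with the homomorphism \<open>mat\<close>.
\<close>

definition (in monoid) drazin :: "'a \<Rightarrow> 'a \<Rightarrow> bool" where
  "drazin a x \<longleftrightarrow> a \<in> carrier G \<and> x \<in> carrier G \<and>
     (\<exists>m::nat. a [^] Suc m \<otimes> x = a [^] m) \<and> x \<otimes> a \<otimes> x = x \<and> a \<otimes> x = x \<otimes> a"

context monoid begin

lemma pow_Suc_absorb_mono:
  fixes m j :: nat
  assumes a: "a \<in> carrier G" and x: "x \<in> carrier G"
    and eq: "a [^] Suc m \<otimes> x = a [^] m" and "m \<le> j"
  shows "a [^] Suc j \<otimes> x = a [^] j"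
  using \<open>m \<le> j\<close>
proof (induction rule: dec_induct)
  case (step j)
  have "a [^] Suc (Suc j) \<otimes> x = a \<otimes> (a [^] Suc j \<otimes> x)"
    using a x by (simp only: nat_pow_Suc2[OF a, of "Suc j"] m_assoc nat_pow_closed)
  also have "\<dots> = a [^] Suc j" by (simp only: step.IH) (simp only: nat_pow_Suc2[OF a, of j])
  finally show ?case .
qed (rule eq)

lemma pow_absorb_iterate:
  fixes m j :: nat
  assumes a: "a \<in> carrier G" and x: "x \<in> carrier G"
    and eq: "a [^] Suc m \<otimes> x = a [^] m"
  shows "a [^] (m + j) \<otimes> x [^] j = a [^] m"
proof (induction j)
  case (Suc j)
  have "a [^] (m + Suc j) \<otimes> x [^] Suc j = (a [^] Suc (m + j) \<otimes> x) \<otimes> x [^] j"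
    using a x by (simp only: nat_pow_Suc2[OF x, of j] m_assoc nat_pow_closed add_Suc_right)
  also have "\<dots> = a [^] (m + j) \<otimes> x [^] j"
    by (simp only: pow_Suc_absorb_mono[OF a x eq, of "m + j"] le_add1)
  finally show ?case using Suc by simp
qed (use a in simp)

lemma pow_absorb_iterate_left:
  fixes m j :: nat
  assumes a: "a \<in> carrier G" and x: "x \<in> carrier G"
    and eq: "x \<otimes> a [^] Suc m = a [^] m"
  shows "x [^] j \<otimes> a [^] (m + j) = a [^] m"
proof (induction j)
  case (Suc j)
  have "x \<otimes> a [^] Suc (m + i) = a [^] (m + i)" for i
  proof -
    have "x \<otimes> a [^] Suc (m + i) = x \<otimes> a [^] Suc m \<otimes> a [^] i"
      using a x nat_pow_mult[OF a, of "Suc m" i] by (simp only: m_assoc nat_pow_closed) simp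
    thus ?thesis using a by (simp only: eq nat_pow_mult)
  qed
  note step = this
  have "x [^] Suc j \<otimes> a [^] (m + Suc j) = x [^] j \<otimes> (x \<otimes> a [^] Suc (m + j))"
    using a x by (simp only: nat_pow_Suc m_assoc nat_pow_closed add_Suc_right m_closed)
  thus ?case using Suc by (simp only: step)
qed (use a in simp)

text \<open>
  Since \<open>ax\<close> is idempotent, \<open>x a = x\<^sup>j\<^sup>+\<^sup>1 a\<^sup>j\<^sup>+\<^sup>1\<close> for every \<open>j\<close>, and similarly for \<open>y\<close>. For \<open>j\<close> at
  least both exponents, \<open>a\<^sup>j\<^sup>+\<^sup>1 x = a\<^sup>j = a\<^sup>j\<^sup>+\<^sup>1 y\<close>, from which both \<open>x\<close> and \<open>y\<close>
  are equal to \<open>x a y\<close>.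
\<close>

lemma drazin_unique:
  assumes "drazin a x" "drazin a y"
  shows "x = y"
proof -
  from assms have a: "a \<in> carrier G" and x: "x \<in> carrier G" and y: "y \<in> carrier G"
    and xax: "x \<otimes> a \<otimes> x = x" and yay: "y \<otimes> a \<otimes> y = y"
    and ax: "a \<otimes> x = x \<otimes> a" and ay: "a \<otimes> y = y \<otimes> a"
    by (auto simp: drazin_def)
  from assms obtain k m :: nat where k: "a [^] Suc k \<otimes> x = a [^] k"
    and m: "a [^] Suc m \<otimes> y = a [^] m" by (auto simp: drazin_def)
  define j where "j = max k m"
  have jx: "a [^] Suc j \<otimes> x = a [^] j" and jy: "a [^] Suc j \<otimes> y = a [^] j"
    using pow_Suc_absorb_mono[OF a x k, of j] pow_Suc_absorb_mono[OF a y m, of j] by (auto simp: j_def)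
  have id: "(a \<otimes> x) [^] Suc i = a \<otimes> x" if "x \<in> carrier G" "x \<otimes> a \<otimes> x = x" for x and i :: nat
  proof (induction i)
    case (Suc i)
    have "(a \<otimes> x) [^] Suc (Suc i) = (a \<otimes> x) \<otimes> (a \<otimes> x)"
      using Suc by (simp only: nat_pow_Suc[of _ "Suc i"])
    also have "\<dots> = a \<otimes> (x \<otimes> a \<otimes> x)" using a that(1) by (simp add: m_assoc)
    finally show ?case by (simp add: that(2))
  qed (use a that in simp)
  have idx: "x [^] Suc j \<otimes> a [^] Suc j = x \<otimes> a"
    using id[OF x xax, of j] pow_mult_distrib[OF ax[symmetric] x a, of "Suc j"] ax by metis
  have idy: "a [^] Suc j \<otimes> y [^] Suc j = a \<otimes> y"
    using id[OF y yay, of j] pow_mult_distrib[OF ay a y, of "Suc j"] ay by metis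
  have xj: "x \<otimes> a [^] Suc j = a [^] j"
    using jx group_commutes_pow[OF ax a x, of "Suc j"] by simp
  have "x = x \<otimes> a \<otimes> x" by (simp add: xax)
  also have "\<dots> = x [^] Suc j \<otimes> (a [^] Suc j \<otimes> x)"
    unfolding idx[symmetric] using a x by (simp only: m_assoc nat_pow_closed)
  also have "\<dots> = x [^] Suc j \<otimes> (a [^] Suc j \<otimes> y)" by (simp only: jx jy)
  also have "\<dots> = x \<otimes> a \<otimes> y"
    using a x y idx by (simp only: m_assoc[symmetric] nat_pow_closed)
  finally have 1: "x = x \<otimes> a \<otimes> y" .
  have "y = a [^] j \<otimes> y [^] Suc j"
  proof -
    have "y = (a \<otimes> y) \<otimes> y" using yay ay by simp
    also have "\<dots> = y \<otimes> (a \<otimes> y)" using ay a y by (simp add: m_assoc)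
    also have "\<dots> = (y \<otimes> a [^] Suc j) \<otimes> y [^] Suc j"
      unfolding idy[symmetric] using a y by (simp only: m_assoc nat_pow_closed)
    also have "y \<otimes> a [^] Suc j = a [^] j"
      using jy group_commutes_pow[OF ay a y, of "Suc j"] by simp
    finally show ?thesis .
  qed
  also have "\<dots> = x \<otimes> (a [^] Suc j \<otimes> y [^] Suc j)"
    unfolding xj[symmetric] using a x y by (simp only: m_assoc nat_pow_closed)
  also have "\<dots> = x \<otimes> a \<otimes> y" unfolding idy using a x y by (simp add: m_assoc)
  finally show ?thesis using 1 by simp
qed

text \<open>
  Iterating the hypotheses gives \<open>a\<^sup>m = a\<^sup>2\<^sup>m\<^sup>+\<^sup>1 p = q a\<^sup>2\<^sup>m\<^sup>+\<^sup>1\<close> for some \<open>m\<close>, \<open>p\<close> and \<open>q\<close>.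
  Then \<open>q a\<^sup>m = q a\<^sup>2\<^sup>m\<^sup>+\<^sup>1 p = a\<^sup>m p\<close>, and this element is the inverse.
\<close>

lemma drazin_exists:
  fixes k l :: nat
  assumes a: "a \<in> carrier G" and z: "z \<in> carrier G" and w: "w \<in> carrier G"
    and az: "a [^] Suc k \<otimes> z = a [^] k" and wa: "w \<otimes> a [^] Suc l = a [^] l"
  shows "\<exists>x. drazin a x"
proof -
  define m where "m = max k l"
  define p q where "p = z [^] Suc m" and "q = w [^] Suc m"
  have p: "p \<in> carrier G" and q: "q \<in> carrier G" using z w by (auto simp: p_def q_def)
  have ac: "a [^] i \<in> carrier G" for i :: nat using a by simp
  have "w \<otimes> a [^] Suc m = a [^] m"
  proof -
    have "a [^] Suc m = a [^] Suc l \<otimes> a [^] (m - l)" "a [^] m = a [^] l \<otimes> a [^] (m - l)"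
      using nat_pow_mult[OF a, of "Suc l" "m - l"] nat_pow_mult[OF a, of l "m - l"] by (simp_all add: m_def)
    thus ?thesis using a w ac wa by (metis m_assoc)
  qed
  note qa' = pow_absorb_iterate_left[OF a w this, of "Suc m"]
  have "a [^] Suc m \<otimes> z = a [^] m"
    by (rule pow_Suc_absorb_mono[OF a z az]) (simp add: m_def)
  note ap' = pow_absorb_iterate[OF a z this, of "Suc m"]
  let ?n = "m + Suc m"
  have ap: "a [^] ?n \<otimes> p = a [^] m" and qa: "q \<otimes> a [^] ?n = a [^] m"
    using ap' qa' by (simp_all only: p_def q_def)
  define x where "x = q \<otimes> a [^] m"
  have xp: "x = a [^] m \<otimes> p"
    using m_assoc[OF q ac[of ?n] p] by (simp only: ap qa x_def)
  have x: "x \<in> carrier G" using q a by (simp add: x_def)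
  have xr: "a [^] Suc m \<otimes> x = a [^] m"
    using ap p by (simp only: xp m_assoc[OF ac ac p, symmetric] nat_pow_mult[OF a] add.commute)
  have axp: "a \<otimes> x = a [^] Suc m \<otimes> p"
    using a p ac[of m] by (simp only: xp m_assoc[symmetric] nat_pow_Suc2)
  have xaq: "x \<otimes> a = q \<otimes> a [^] Suc m"
    using a q ac[of m] by (simp only: x_def m_assoc nat_pow_Suc)
  have comm: "a \<otimes> x = x \<otimes> a"
  proof -
    have "x \<otimes> a = q \<otimes> (a \<otimes> a [^] m)"
      using a q ac[of m] by (simp only: xaq nat_pow_Suc2)
    also have "\<dots> = q \<otimes> (a \<otimes> (a [^] ?n \<otimes> p))" by (simp only: ap)
    also have "\<dots> = q \<otimes> (a [^] ?n \<otimes> a) \<otimes> p"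
    proof -
      have "a \<otimes> a [^] ?n = a [^] ?n \<otimes> a" using nat_pow_Suc2[OF a, of ?n] by simp
      hence "a \<otimes> (a [^] ?n \<otimes> p) = a [^] ?n \<otimes> a \<otimes> p"
        using m_assoc[OF a ac[of ?n] p] by simp
      thus ?thesis using a p q ac[of ?n] by (simp only: m_assoc m_closed)
    qed
    also have "\<dots> = (q \<otimes> a [^] ?n) \<otimes> a \<otimes> p"
      using a p q ac[of ?n] by (simp only: m_assoc m_closed)
    also have "\<dots> = a [^] Suc m \<otimes> p" by (simp only: qa nat_pow_Suc)
    finally show ?thesis by (simp only: axp)
  qed
  have "x \<otimes> a \<otimes> x = q \<otimes> (a [^] Suc m \<otimes> x)" 
    using q x ac[of "Suc m"] by (simp only: xaq m_assoc)
  hence "x \<otimes> a \<otimes> x = x" by (simp only: xr) (simp only: x_def)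
  thus ?thesis using a x xr comm by (auto simp: drazin_def)
qed

text \<open>
  Writing \<open>a\<^sup>k = a\<^sup>k\<^sup>+\<^sup>m z\<^sup>m\<close> reduces the claim to the exponent \<open>k + m\<close>, which lies above the one
  in the hypothesis on \<open>x\<close>.
\<close>

lemma drazin_absorb_at_index:
  fixes k :: nat
  assumes d: "drazin a x" and z: "z \<in> carrier G" and az: "a [^] Suc k \<otimes> z = a [^] k"
  shows "a [^] Suc k \<otimes> x = a [^] k"
proof -
  from d have a: "a \<in> carrier G" and x: "x \<in> carrier G" and ax: "a \<otimes> x = x \<otimes> a"
    by (auto simp: drazin_def)
  from d obtain m :: nat where m: "a [^] Suc m \<otimes> x = a [^] m" by (auto simp: drazin_def)
  have km: "a [^] (k + m) \<otimes> z [^] m = a [^] k" by (rule pow_absorb_iterate[OF a z az])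
  have "a [^] Suc (k + m) \<otimes> x = a [^] (k + m)" by (rule pow_Suc_absorb_mono[OF a x m]) simp
  hence xkm: "x \<otimes> a [^] Suc (k + m) = a [^] (k + m)"
    using group_commutes_pow[OF ax a x, of "Suc (k + m)"] by simp
  have "a [^] Suc k \<otimes> x = x \<otimes> a [^] Suc k" by (rule group_commutes_pow[OF ax a x])
  also have "\<dots> = x \<otimes> (a \<otimes> (a [^] (k + m) \<otimes> z [^] m))" by (simp only: km nat_pow_Suc2[OF a])
  also have "\<dots> = x \<otimes> a [^] Suc (k + m) \<otimes> z [^] m"
    using a x z by (simp only: nat_pow_Suc2 m_assoc m_closed nat_pow_closed)
  also have "\<dots> = a [^] k" by (simp only: xkm km)
  finally show ?thesis .
qed

end


lemma (in monoid) drazin_conjugate: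
  assumes d: "drazin a x" and u: "u \<in> carrier G" and w: "w \<in> carrier G"
    and wu: "w \<otimes> u = \<one>" and uw: "u \<otimes> w = \<one>"
  shows "drazin (u \<otimes> a \<otimes> w) (u \<otimes> x \<otimes> w)"
proof -
  from d have a: "a \<in> carrier G" and x: "x \<in> carrier G" and xax: "x \<otimes> a \<otimes> x = x"
    and ax: "a \<otimes> x = x \<otimes> a" by (auto simp: drazin_def)
  from d obtain m :: nat where m: "a [^] Suc m \<otimes> x = a [^] m" by (auto simp: drazin_def)
  have mult: "(u \<otimes> b \<otimes> w) \<otimes> (u \<otimes> c \<otimes> w) = u \<otimes> (b \<otimes> c) \<otimes> w"
    if b: "b \<in> carrier G" and c: "c \<in> carrier G" for b c
  proof -
    have "(u \<otimes> b \<otimes> w) \<otimes> (u \<otimes> c \<otimes> w) = u \<otimes> b \<otimes> (w \<otimes> u) \<otimes> c \<otimes> w"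
      using b c u w by (simp only: m_assoc m_closed)
    thus ?thesis using b c u w by (simp add: wu m_assoc)
  qed
  have pow: "(u \<otimes> a \<otimes> w) [^] k = u \<otimes> a [^] k \<otimes> w" for k :: nat
  proof (induction k)
    case 0 thus ?case using u w uw by simp
  next
    case (Suc k) thus ?case using mult[of "a [^] k" a] a by simp
  qed
  have "(u \<otimes> a \<otimes> w) [^] Suc m \<otimes> (u \<otimes> x \<otimes> w) = (u \<otimes> a \<otimes> w) [^] m"
    unfolding pow using mult[of "a [^] Suc m" x] a x m by (simp del: nat_pow_Suc)
  moreover have "(u \<otimes> x \<otimes> w) \<otimes> (u \<otimes> a \<otimes> w) \<otimes> (u \<otimes> x \<otimes> w) = u \<otimes> x \<otimes> w"
    using a x by (simp only: mult m_closed xax)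
  moreover have "(u \<otimes> a \<otimes> w) \<otimes> (u \<otimes> x \<otimes> w) = (u \<otimes> x \<otimes> w) \<otimes> (u \<otimes> a \<otimes> w)"
    using a x by (simp only: mult ax)
  ultimately show ?thesis unfolding drazin_def using a x u w by blast
qed

section \<open>Drazin inverses of complex matrices\<close>

context vec_space begin

text \<open>
  The column space of \<open>AC\<close> is contained in that of \<open>A\<close>. If the dimensions agree, so do the spaces,
  and then the columns of \<open>A\<close> are combinations of those of \<open>AC\<close>.
\<close>

lemma rank_mult_le:
  assumes A: "A \<in> carrier_mat n m" and C: "C \<in> carrier_mat m l"
  shows "rank (A * C) \<le> rank A"
    and "rank (A * C) = rank A \<Longrightarrow> \<exists>D \<in> carrier_mat l m. A = A * C * D"
proof -
  let ?A = "span (set (cols A))" and ?B = "span (set (cols (A * C)))"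
  have AC: "A * C \<in> carrier_mat n l" using A C by auto
  have cA: "set (cols A) \<subseteq> carrier_vec n" and cB: "set (cols (A * C)) \<subseteq> carrier_vec n"
    using cols_dim[of A] cols_dim[of "A * C"] A AC by auto
  have spA: "?A = {y \<in> carrier_vec n. \<exists>x \<in> carrier_vec m. A *\<^sub>v x = y}"
    using col_space_eq[OF A] A unfolding col_space_def by auto
  have spB: "?B = {y \<in> carrier_vec n. \<exists>x \<in> carrier_vec l. (A * C) *\<^sub>v x = y}"
    using col_space_eq[OF AC] A C unfolding col_space_def by auto
  have sub: "?B \<subseteq> ?A"
  proof
    fix y assume "y \<in> ?B"
    then obtain x where y: "y \<in> carrier_vec n" and x: "x \<in> carrier_vec l" and "(A * C) *\<^sub>v x = y"
      unfolding spB by auto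
    hence "A *\<^sub>v (C *\<^sub>v x) = y" using A C by (simp add: assoc_mult_mat_vec)
    thus "y \<in> ?A" unfolding spA using y x C by auto
  qed
  have vA: "vectorspace class_ring (vs ?A)" and vB: "vectorspace class_ring (vs ?B)"
    using span_is_subspace[OF cA, THEN subspace_is_vs] span_is_subspace[OF cB, THEN subspace_is_vs] by auto
  have smA: "submodule class_ring ?A V" and smB: "submodule class_ring ?B V"
    using span_is_submodule[OF cA] span_is_submodule[OF cB] by auto
  have fdA: "vectorspace.fin_dim class_ring (vs ?A)" and fdB: "vectorspace.fin_dim class_ring (vs ?B)"
    using fin_dim_span_cols[OF A] fin_dim_span_cols[OF AC] by auto
  obtain b where b: "finite b" "vectorspace.basis class_ring (vs ?B) b"
    using vectorspace.finite_basis_exists[OF vB fdB] by auto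
  hence b': "b \<subseteq> ?B" "LinearCombinations.module.lin_indpt class_ring (vs ?B) b"
      "LinearCombinations.module.span class_ring (vs ?B) b = ?B"
    using vectorspace.basis_def[OF vB] by auto
  have card: "rank (A * C) = card b" unfolding rank_def
    using vectorspace.dim_basis[OF vB b] .
  have bA: "b \<subseteq> ?A" using b'(1) sub by auto
  have liA: "LinearCombinations.module.lin_indpt class_ring (vs ?A) b"
    using b'(2) span_li_not_depend(2)[OF b'(1) smB] span_li_not_depend(2)[OF bA smA] by auto
  show "rank (A * C) \<le> rank A"
    unfolding card unfolding rank_def
    by (rule vectorspace.li_le_dim(2)[OF vA fdA _ liA]) (use bA in auto)
  assume eq: "rank (A * C) = rank A"
  have "vectorspace.basis class_ring (vs ?A) b"
    by (rule vectorspace.dim_li_is_basis[OF vA fdA b(1) _ liA])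
       (use bA eq card in \<open>auto simp: rank_def\<close>)
  hence "LinearCombinations.module.span class_ring (vs ?A) b = ?A"
    using vectorspace.basis_def[OF vA] by auto
  hence "?A = ?B"
    using b'(3) span_li_not_depend(1)[OF b'(1) smB] span_li_not_depend(1)[OF bA smA] by auto
  hence "\<forall>i < m. \<exists>x \<in> carrier_vec l. (A * C) *\<^sub>v x = col A i"
  proof (intro allI impI)
    fix i assume eq: "?A = ?B" and "i < m"
    hence "col A i \<in> set (cols A)" using A by (auto simp: cols_def)
    hence "col A i \<in> ?A" using in_own_span[OF cA] by auto
    thus "\<exists>x \<in> carrier_vec l. (A * C) *\<^sub>v x = col A i" unfolding eq spB by auto
  qed
  then obtain f where f: "\<And>i. i < m \<Longrightarrow> f i \<in> carrier_vec l \<and> (A * C) *\<^sub>v f i = col A i"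
    by metis
  define D where "D = mat_of_cols l (map f [0..<m])"
  have D: "D \<in> carrier_mat l m" unfolding D_def by (rule mat_of_cols_carrier(1)[of l "map f [0..<m]", simplified])
  have "A = A * C * D"
  proof (rule mat_col_eqI)
    fix i assume "i < dim_col (A * C * D)"
    hence i: "i < m" using D by simp
    have "col D i = f i" using i f unfolding D_def by (subst col_mat_of_cols) auto
    thus "col A i = col (A * C * D) i"
      using f[OF i] i D AC by (subst col_mult2[OF AC D i]) auto
  qed (use A C D in auto)
  thus "\<exists>D \<in> carrier_mat l m. A = A * C * D" using D by blast
qed

end

lemma decreasing_nat_stabilises:
  fixes f :: "nat \<Rightarrow> nat"
  assumes "\<And>k. f (Suc k) \<le> f k"
  shows "\<exists>k. f (Suc k) = f k"
proof (rule ccontr)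
  assume "\<not> ?thesis"
  hence *: "f (Suc k) < f k" for k using assms[of k] by (metis le_neq_implies_less)
  have "f k + k \<le> f 0" for k
  proof (induction k)
    case (Suc k)
    thus ?case using *[of k] by linarith
  qed simp
  from this[of "Suc (f 0)"] show False by simp
qed

abbreviation mat_monoid :: "nat \<Rightarrow> complex mat ring" where
  "mat_monoid n \<equiv> ring_mat TYPE(complex) n ()"

lemma monoid_mat: "monoid (mat_monoid n)"
  by (rule semiring.axioms(2)[OF semiring_mat])

text \<open>
  The ranks of the powers decrease and therefore stabilise, so the least exponent that defines the
  index exists. The two powers at the index then have equal ranks.
\<close>

lemma mat_index_absorb:
  fixes A :: "complex mat"
  assumes A: "A \<in> carrier_mat n n"
  shows "\<exists>D \<in> carrier_mat n n. A ^\<^sub>m Suc (mat_index A) * D = A ^\<^sub>m (mat_index A)"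
proof -
  have "vec_space.rank n (A ^\<^sub>m Suc k) \<le> vec_space.rank n (A ^\<^sub>m k)" for k
    using vec_space.rank_mult_le(1)[OF pow_carrier_mat[OF A] A, of k] by simp
  hence "\<exists>k. vec_space.rank n (A ^\<^sub>m k) = vec_space.rank n (A ^\<^sub>m (k + 1))"
    using decreasing_nat_stabilises[of "\<lambda>k. vec_space.rank n (A ^\<^sub>m k)"] by (metis Suc_eq_plus1)
  hence "vec_space.rank n (A ^\<^sub>m mat_index A) = vec_space.rank n (A ^\<^sub>m (mat_index A + 1))"
    unfolding mat_index_def carrier_matD(1)[OF A] by (rule LeastI_ex)
  thus ?thesis
    using vec_space.rank_mult_le(2)[OF pow_carrier_mat[OF A] A, of "mat_index A"] by simp metis
qed

lemma transpose_pow_mat: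
  fixes A :: "complex mat"
  assumes A: "A \<in> carrier_mat n n"
  shows "transpose_mat (A ^\<^sub>m k) = transpose_mat A ^\<^sub>m k"
proof (induction k)
  case (Suc k)
  have t: "transpose_mat A \<in> carrier_mat n n" using A by simp
  interpret monoid "mat_monoid n" by (rule monoid_mat)
  have "transpose_mat (A ^\<^sub>m Suc k) = transpose_mat A * transpose_mat A ^\<^sub>m k"
    using Suc by (simp add: transpose_mult[OF pow_carrier_mat[OF A] A])
  also have "\<dots> = transpose_mat A ^\<^sub>m Suc k"
    using nat_pow_Suc2[of "transpose_mat A" k] t
    by (simp only: pow_mat_ring_pow[OF t, of _ "()"]) (simp add: ring_mat_def)
  finally show ?case .
qed (use A in simp)

text \<open>
  The right divisibility at the index of \<open>A\<close>, together with the transpose of the one at the index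
  of the transposed matrix.
\<close>

lemma matrix_drazin_exists:
  assumes A: "A \<in> carrier_mat n n"
  shows "\<exists>X. monoid.drazin (mat_monoid n) A X"
proof -
  have t: "transpose_mat A \<in> carrier_mat n n" using A by simp
  obtain Z where Z: "Z \<in> carrier_mat n n" "A ^\<^sub>m Suc (mat_index A) * Z = A ^\<^sub>m (mat_index A)"
    using mat_index_absorb[OF A] by auto
  let ?l = "mat_index (transpose_mat A)"
  obtain W where W: "W \<in> carrier_mat n n" "transpose_mat A ^\<^sub>m Suc ?l * W = transpose_mat A ^\<^sub>m ?l"
    using mat_index_absorb[OF t] by auto
  have "transpose_mat (transpose_mat A ^\<^sub>m Suc ?l * W) = transpose_mat W * A ^\<^sub>m Suc ?l"
    using transpose_mult[OF pow_carrier_mat[OF t] W(1), of "Suc ?l"] transpose_pow_mat[OF t, of "Suc ?l"]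
    by (simp del: pow_mat.simps)
  hence W': "transpose_mat W * A ^\<^sub>m Suc ?l = A ^\<^sub>m ?l"
    using W(2) transpose_pow_mat[OF t, of ?l] by (simp del: pow_mat.simps)
  show ?thesis
    by (rule monoid.drazin_exists[OF monoid_mat, of _ _ Z "transpose_mat W"])
       (use A Z W W' in \<open>simp_all only: pow_mat_ring_pow[OF A, of _ "()"] ring_mat_simps transpose_carrier_mat\<close>)
qed

lemma mat_drazin_iff:
  "monoid.drazin (mat_monoid n) A X \<longleftrightarrow> A \<in> carrier_mat n n \<and> X \<in> carrier_mat n n \<and>
     (\<exists>m. A ^\<^sub>m Suc m * X = A ^\<^sub>m m) \<and> X * A * X = X \<and> A * X = X * A"
proof -
  have "(\<exists>m::nat. A [^]\<^bsub>mat_monoid n\<^esub> Suc m * X = A [^]\<^bsub>mat_monoid n\<^esub> m) \<longleftrightarrow>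
      (\<exists>m. A ^\<^sub>m Suc m * X = A ^\<^sub>m m)" if A: "A \<in> carrier_mat n n"
    by (simp only: pow_mat_ring_pow[OF A, of _ "()"])
  thus ?thesis unfolding monoid.drazin_def[OF monoid_mat] ring_mat_simps by blast
qed

section \<open>The Drazin inverse of a tensor\<close>

lemma tensor_drazin_iff:
  assumes t: "t > 0" and A: "A \<in> tensors n n t"
  shows "monoid.drazin (tensor_monoid n t) A X \<longleftrightarrow> X \<in> tensors n n t \<and>
     (\<exists>m. A ^\<^sub>c Suc m *\<^sub>c X = A ^\<^sub>c m) \<and> X *\<^sub>c A *\<^sub>c X = X \<and> A *\<^sub>c X = X *\<^sub>c A"
  unfolding monoid.drazin_def[OF monoid_tensors[OF t]] tensor_monoid_simps
    tensor_pow_monoid[OF t A] using A by blast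

text \<open>
  The exponents of the slices may differ; their sum bounds all of them and works for every slice.
\<close>

lemma tensor_drazin_slicewise:
  assumes t: "t > 0" and A: "A \<in> tensors n n t" and X: "X \<in> tensors n n t"
  shows "monoid.drazin (tensor_monoid n t) A X \<longleftrightarrow>
    (\<forall>i<t. monoid.drazin (mat_monoid n) (cosine_transform A ! i) (cosine_transform X ! i))"
proof
  let ?L = cosine_transform
  note pr = c_product_slices[OF t] and pw = tensor_pow_slices[OF t A]
  note cA = cosine_transform_slice_carrier[OF A] and cX = cosine_transform_slice_carrier[OF X]
  {
    assume "monoid.drazin (tensor_monoid n t) A X"
    then obtain m where m: "A ^\<^sub>c Suc m *\<^sub>c X = A ^\<^sub>c m"
      and xax: "X *\<^sub>c A *\<^sub>c X = X" and ax: "A *\<^sub>c X = X *\<^sub>c A"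
      unfolding tensor_drazin_iff[OF t A] by blast
    show "\<forall>i<t. monoid.drazin (mat_monoid n) (?L A ! i) (?L X ! i)"
    proof (intro allI impI)
      fix i assume i: "i < t"
      have "?L A ! i ^\<^sub>m Suc m * ?L X ! i = ?L A ! i ^\<^sub>m m"
        using arg_cong[OF m, of "\<lambda>T. ?L T ! i"]
        by (simp only: pr(2)[OF pw(1) X i] pw(2)[OF i])
      moreover have "?L X ! i * ?L A ! i * ?L X ! i = ?L X ! i"
        using arg_cong[OF xax, of "\<lambda>T. ?L T ! i"]
        by (simp only: pr(2)[OF pr(1)[OF X A] X i] pr(2)[OF X A i])
      moreover have "?L A ! i * ?L X ! i = ?L X ! i * ?L A ! i"
        using arg_cong[OF ax, of "\<lambda>T. ?L T ! i"] by (simp only: pr(2)[OF A X i] pr(2)[OF X A i])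
      ultimately show "monoid.drazin (mat_monoid n) (?L A ! i) (?L X ! i)"
        unfolding mat_drazin_iff using cA[OF i] cX[OF i] by blast
    qed
  next
    assume d: "\<forall>i<t. monoid.drazin (mat_monoid n) (?L A ! i) (?L X ! i)"
    hence "\<forall>i<t. \<exists>m. ?L A ! i ^\<^sub>m Suc m * ?L X ! i = ?L A ! i ^\<^sub>m m"
      unfolding mat_drazin_iff by blast
    then obtain e where e: "\<And>i. i < t \<Longrightarrow> ?L A ! i ^\<^sub>m Suc (e i) * ?L X ! i = ?L A ! i ^\<^sub>m e i"
      by metis
    define m where "m = (\<Sum>i<t. e i)"
    have m: "?L A ! i ^\<^sub>m Suc m * ?L X ! i = ?L A ! i ^\<^sub>m m" if i: "i < t" for i
    proof -
      have "e i \<le> m" unfolding m_def by (rule member_le_sum) (use i in auto)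
      thus ?thesis
        using monoid.pow_Suc_absorb_mono[OF monoid_mat, of "?L A ! i" n "?L X ! i" "e i" m] cA[OF i] cX[OF i] e[OF i]
        by (simp only: pow_mat_ring_pow[OF cA[OF i], of _ "()"] ring_mat_simps)
    qed
    have "A ^\<^sub>c Suc m *\<^sub>c X = A ^\<^sub>c m"
      by (rule cosine_transform_eqD[OF pr(1)[OF pw(1) X] pw(1)])
         (simp only: pr(2)[OF pw(1) X] pw(2) m)
    moreover have "X *\<^sub>c A *\<^sub>c X = X"
      by (rule cosine_transform_eqD[OF pr(1)[OF pr(1)[OF X A] X] X])
         (use d in \<open>simp add: pr(2)[OF pr(1)[OF X A] X] pr(2)[OF X A] mat_drazin_iff\<close>)
    moreover have "A *\<^sub>c X = X *\<^sub>c A"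
      by (rule cosine_transform_eqD[OF pr(1)[OF A X] pr(1)[OF X A]])
         (use d in \<open>simp add: pr(2)[OF X A] pr(2)[OF A X] mat_drazin_iff\<close>)
    ultimately show "monoid.drazin (tensor_monoid n t) A X"
      unfolding tensor_drazin_iff[OF t A] using X by blast
  }
qed

lemma tensor_drazin_exists:
  assumes t: "t > 0" and A: "A \<in> tensors n n t"
  shows "\<exists>X. monoid.drazin (tensor_monoid n t) A X"
proof -
  have "\<forall>i. \<exists>Y. i < t \<longrightarrow> monoid.drazin (mat_monoid n) (cosine_transform A ! i) Y"
    using matrix_drazin_exists cosine_transform_slice_carrier[OF A] by blast
  then obtain F where F: "\<And>i. i < t \<Longrightarrow> monoid.drazin (mat_monoid n) (cosine_transform A ! i) (F i)"
    by metis
  hence "F i \<in> carrier_mat n n" if "i < t" for i using that unfolding mat_drazin_iff by blast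
  then obtain X where X: "X \<in> tensors n n t" "\<forall>i<t. cosine_transform X ! i = F i"
    using cosine_transform_surj[of t F n n] by blast
  thus ?thesis using tensor_drazin_slicewise[OF t A X(1)] F by auto
qed

text \<open>
  The exponent equation is transported to the matrix \<open>mat(A)\<close>, where the equation at its index
  follows from the one at any exponent, and it is pulled back by injectivity.
\<close>

lemma is_drazin_inverse_iff:
  assumes t: "t > 0" and A: "A \<in> tensors n n t"
  shows "is_drazin_inverse A X \<longleftrightarrow> monoid.drazin (tensor_monoid n t) A X"
proof
  assume "is_drazin_inverse A X"
  thus "monoid.drazin (tensor_monoid n t) A X"
    unfolding is_drazin_inverse_def tensor_drazin_iff[OF t A] Suc_eq_plus1[symmetric]
      tensors_dims(1)[OF A] tensors_dims(2,3)[OF A t] by blast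
next
  let ?k = "tensor_index A" and ?m = tensor_mat
  note pr = c_product_slices(1)[OF t] and pw = tensor_pow_slices(1)[OF t A]
  assume "monoid.drazin (tensor_monoid n t) A X"
  then obtain m where X: "X \<in> tensors n n t" and m: "A ^\<^sub>c Suc m *\<^sub>c X = A ^\<^sub>c m"
      and xax: "X *\<^sub>c A *\<^sub>c X = X" and ax: "A *\<^sub>c X = X *\<^sub>c A"
    unfolding tensor_drazin_iff[OF t A] by blast
  note mA = tensor_mat_carrier[OF t A] and mX = tensor_mat_carrier[OF t X]
  have "?m A ^\<^sub>m Suc m * ?m X = ?m A ^\<^sub>m m"
    using arg_cong[OF m, of ?m] by (simp only: tensor_mat_c_product[OF t pw X] tensor_mat_pow[OF t A])
  moreover have "?m X * ?m A * ?m X = ?m X"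
    using arg_cong[OF xax, of ?m] by (simp only: tensor_mat_c_product[OF t pr[OF X A] X] tensor_mat_c_product[OF t X A])
  moreover have "?m A * ?m X = ?m X * ?m A"
    using arg_cong[OF ax, of ?m] by (simp only: tensor_mat_c_product[OF t A X] tensor_mat_c_product[OF t X A])
  ultimately have d: "monoid.drazin (mat_monoid (t * n)) (?m A) (?m X)"
    unfolding mat_drazin_iff using mA mX by blast
  obtain D where D: "D \<in> carrier_mat (t * n) (t * n)" "?m A ^\<^sub>m Suc ?k * D = ?m A ^\<^sub>m ?k"
    using mat_index_absorb[OF mA] unfolding tensor_index_def by blast
  have "?m A ^\<^sub>m Suc ?k * ?m X = ?m A ^\<^sub>m ?k"
    using monoid.drazin_absorb_at_index[OF monoid_mat d, of D ?k] D
    by (simp only: pow_mat_ring_pow[OF mA, of _ "()"] ring_mat_simps)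
  hence "?m (A ^\<^sub>c Suc ?k *\<^sub>c X) = ?m (A ^\<^sub>c ?k)"
    by (simp only: tensor_mat_c_product[OF t pw X] tensor_mat_pow[OF t A])
  hence "A ^\<^sub>c Suc ?k *\<^sub>c X = A ^\<^sub>c ?k"
    by (rule tensor_mat_inj[OF pr[OF pw X] pw t])
  thus "is_drazin_inverse A X"
    unfolding is_drazin_inverse_def Suc_eq_plus1[symmetric]
      tensors_dims(1)[OF A] tensors_dims(2,3)[OF A t] using X xax ax by blast
qed

lemma drazin_inverse_eqI:
  assumes t: "t > 0" and A: "A \<in> tensors n n t" and d: "monoid.drazin (tensor_monoid n t) A X"
  shows "A\<^sup>D = X"
  unfolding drazin_inverse_def is_drazin_inverse_iff[OF t A]
proof (rule the_equality)
  show "monoid.drazin (tensor_monoid n t) A X" by (rule d)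
  show "Y = X" if "monoid.drazin (tensor_monoid n t) A Y" for Y
    by (rule monoid.drazin_unique[OF monoid_tensors[OF t] that d])
qed

lemma drazin_inverse_drazin:
  assumes t: "t > 0" and A: "A \<in> tensors n n t"
  shows "monoid.drazin (tensor_monoid n t) A (A\<^sup>D)"
  using tensor_drazin_exists[OF t A] drazin_inverse_eqI[OF t A] by auto

section \<open>The formula for the C-HS decomposition\<close>

lemma mult_block_row:
  fixes B C X Z :: "complex mat"
  assumes "B \<in> carrier_mat r r" "C \<in> carrier_mat r s" "X \<in> carrier_mat r r" "Z \<in> carrier_mat r s"
  shows "four_block_mat B C (0\<^sub>m s r) (0\<^sub>m s s) * four_block_mat X Z (0\<^sub>m s r) (0\<^sub>m s s)
    = four_block_mat (B * X) (B * Z) (0\<^sub>m s r) (0\<^sub>m s s)"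
  using assms by (subst mult_four_block_mat[of _ r r _ s _ s _ _ r _ s]) auto

text \<open>
  If \<open>m\<close> is an exponent for \<open>B\<close>, the exponent \<open>m + 1\<close> works for the block matrix: the top right
  block of its \<open>(m + 1)\<close>-st power is \<open>B\<^sup>m C\<close>.
\<close>

lemma block_row_drazin:
  fixes B C X :: "complex mat"
  assumes d: "monoid.drazin (mat_monoid r) B X" and C: "C \<in> carrier_mat r s"
  shows "monoid.drazin (mat_monoid (r + s)) (four_block_mat B C (0\<^sub>m s r) (0\<^sub>m s s))
    (four_block_mat X (X * X * C) (0\<^sub>m s r) (0\<^sub>m s s))"
proof -
  from d have B: "B \<in> carrier_mat r r" and X: "X \<in> carrier_mat r r"
    and XBX: "X * B * X = X" and BX: "B * X = X * B" by (auto simp: mat_drazin_iff)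
  from d obtain m where m: "B ^\<^sub>m Suc m * X = B ^\<^sub>m m" by (auto simp: mat_drazin_iff)
  let ?M = "four_block_mat B C (0\<^sub>m s r) (0\<^sub>m s s)"
  let ?Y = "four_block_mat X (X * X * C) (0\<^sub>m s r) (0\<^sub>m s s)"
  have Bk: "B ^\<^sub>m k \<in> carrier_mat r r" for k using B by simp
  have BC: "B ^\<^sub>m k * C \<in> carrier_mat r s" for k using Bk C by (rule mult_carrier_mat)
  have XX: "X * X \<in> carrier_mat r r" using X by simp
  have XXC: "X * X * C \<in> carrier_mat r s" using XX C by simp
  have M: "?M \<in> carrier_mat (r + s) (r + s)" using B by simp
  have Y: "?Y \<in> carrier_mat (r + s) (r + s)" using X by simp
  have pow: "?M ^\<^sub>m Suc k = four_block_mat (B ^\<^sub>m Suc k) (B ^\<^sub>m k * C) (0\<^sub>m s r) (0\<^sub>m s s)" for k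
  proof (induction k)
    case 0
    show ?case using B C M by simp
  next
    case (Suc k)
    have "?M ^\<^sub>m Suc (Suc k) = ?M ^\<^sub>m Suc k * ?M" by simp
    also have "\<dots> = four_block_mat (B ^\<^sub>m Suc k * B) (B ^\<^sub>m Suc k * C) (0\<^sub>m s r) (0\<^sub>m s s)"
      unfolding Suc by (rule mult_block_row[OF Bk BC B C])
    finally show ?case by simp
  qed
  have m': "B ^\<^sub>m Suc (Suc m) * X = B ^\<^sub>m Suc m"
    using monoid.pow_Suc_absorb_mono[OF monoid_mat, of B r X m "Suc m"] B X m
    by (simp only: pow_mat_ring_pow[OF B, of _ "()"] ring_mat_simps le_SucI order_refl)
  have "B ^\<^sub>m Suc (Suc m) * (X * X * C) = B ^\<^sub>m Suc (Suc m) * X * X * C"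
    using assoc_mult_mat[OF Bk XX C] assoc_mult_mat[OF Bk X X] by metis
  also have "\<dots> = B ^\<^sub>m m * C" by (simp only: m' m)
  finally have top: "B ^\<^sub>m Suc (Suc m) * (X * X * C) = B ^\<^sub>m m * C" .
  have "?M ^\<^sub>m Suc (Suc m) * ?Y = ?M ^\<^sub>m Suc m"
    unfolding pow mult_block_row[OF Bk BC X XXC] m' top ..
  moreover have "?M * ?Y = four_block_mat (B * X) (X * C) (0\<^sub>m s r) (0\<^sub>m s s)"
  proof -
    have "B * (X * X * C) = B * X * X * C"
      using assoc_mult_mat[OF B XX C] assoc_mult_mat[OF B X X] by metis
    also have "\<dots> = X * C" by (simp only: BX XBX)
    finally show ?thesis by (simp only: mult_block_row[OF B C X XXC])
  qed
  moreover have YM: "?Y * ?M = four_block_mat (X * B) (X * C) (0\<^sub>m s r) (0\<^sub>m s s)"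
    by (rule mult_block_row[OF X XXC B C])
  moreover have "?Y * ?M * ?Y = ?Y"
  proof -
    have XB: "X * B \<in> carrier_mat r r" and XC: "X * C \<in> carrier_mat r s" using X B C by auto
    have "X * B * (X * X * C) = X * B * X * X * C"
      using assoc_mult_mat[OF XB XX C] assoc_mult_mat[OF XB X X] by metis
    hence "X * B * (X * X * C) = X * X * C" by (simp only: XBX)
    thus ?thesis unfolding YM mult_block_row[OF XB XC X XXC] by (simp only: XBX)
  qed
  ultimately show ?thesis unfolding mat_drazin_iff using M Y BX by (metis (no_types))
qed


theorem theorem4p5:
  fixes n1 n3 r :: nat and A U Sr K L :: tensor
  assumes "n3 > 0"
    and "A \<in> tensors n1 n1 n3"
    and "is_C_HS n1 n3 r A U Sr K L"
  shows "A\<^sup>D =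
    U *\<^sub>c block_tensor ((Sr *\<^sub>c K)\<^sup>D) (((Sr *\<^sub>c K)\<^sup>D) ^\<^sub>c 2 *\<^sub>c Sr *\<^sub>c L)
            (zero_tensor (n1 - r) r n3) (zero_tensor (n1 - r) (n1 - r) n3) *\<^sub>c U\<^sup>H"
proof -
  let ?s = "n1 - r" and ?T = cosine_transform
  note t = assms(1) and A = assms(2)
  from assms(3) have rn: "r + ?s = n1" and UU: "unitary_tensor n1 n3 U"
    and Sr: "Sr \<in> tensors r r n3" and K: "K \<in> tensors r r n3" and L: "L \<in> tensors r ?s n3"
    and AU: "A = U *\<^sub>c block_tensor (Sr *\<^sub>c K) (Sr *\<^sub>c L)
                 (zero_tensor ?s r n3) (zero_tensor ?s ?s n3) *\<^sub>c U\<^sup>H"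
    unfolding is_C_HS_def is_C_SVD_def invertible_tensor_def by auto
  from UU have U: "U \<in> tensors n1 n1 n3" and UHU: "U\<^sup>H *\<^sub>c U = id_tensor n1 n3"
    and UUH: "U *\<^sub>c U\<^sup>H = id_tensor n1 n3" by (auto simp: unitary_tensor_def)
  note pr = c_product_slices[OF t]
  note UH = conj_transpose_tensors[OF t U]
  note Z1 = zero_tensor_slices(1)[of ?s r n3] and Z2 = zero_tensor_slices(1)[of ?s ?s n3]
  note SK = pr(1)[OF Sr K] and SL = pr(1)[OF Sr L]
  let ?D = "(Sr *\<^sub>c K)\<^sup>D"
  have dD: "monoid.drazin (tensor_monoid r n3) (Sr *\<^sub>c K) ?D" by (rule drazin_inverse_drazin[OF t SK])
  hence D: "?D \<in> tensors r r n3" unfolding tensor_drazin_iff[OF t SK] by blast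
  note D2 = tensor_pow_slices(1)[OF t D, of 2] tensor_pow_slices(2)[OF t D, where m = 2]
  let ?C = "?D ^\<^sub>c 2 *\<^sub>c Sr *\<^sub>c L"
  have C: "?C \<in> tensors r ?s n3" by (rule pr(1)[OF pr(1)[OF D2(1) Sr] L])
  let ?M = "block_tensor (Sr *\<^sub>c K) (Sr *\<^sub>c L) (zero_tensor ?s r n3) (zero_tensor ?s ?s n3)"
  let ?Y = "block_tensor ?D ?C (zero_tensor ?s r n3) (zero_tensor ?s ?s n3)"
  have M: "?M \<in> tensors n1 n1 n3" and Y: "?Y \<in> tensors n1 n1 n3"
    using block_tensor_slices(1)[OF SK SL Z1 Z2] block_tensor_slices(1)[OF D C Z1 Z2] by (simp_all add: rn)
  \<comment> \<open>It suffices to compare the block tensors slice by slice, before conjugating with \<open>U\<close>.\<close>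
  have "monoid.drazin (mat_monoid n1) (?T ?M ! i) (?T ?Y ! i)" if i: "i < n3" for i
  proof -
    have "?T (?D ^\<^sub>c 2) ! i = ?T ?D ! i * ?T ?D ! i"
      using D2(2)[OF i] cosine_transform_slice_carrier[OF D i] by (simp add: numeral_2_eq_2)
    hence "?T ?C ! i = ?T ?D ! i * ?T ?D ! i * ?T Sr ! i * ?T L ! i"
      by (simp only: pr(2)[OF pr(1)[OF D2(1) Sr] L i] pr(2)[OF D2(1) Sr i])
    also have "\<dots> = ?T ?D ! i * ?T ?D ! i * (?T Sr ! i * ?T L ! i)"
      by (rule assoc_mult_mat[of _ r r _ r _ ?s])
        (use cosine_transform_slice_carrier[OF D i] cosine_transform_slice_carrier[OF Sr i]
           cosine_transform_slice_carrier[OF L i] in auto)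
    also have "?T Sr ! i * ?T L ! i = ?T (Sr *\<^sub>c L) ! i" by (simp only: pr(2)[OF Sr L i])
    finally have TC: "?T ?C ! i = ?T ?D ! i * ?T ?D ! i * ?T (Sr *\<^sub>c L) ! i" .
    have "monoid.drazin (mat_monoid r) (?T (Sr *\<^sub>c K) ! i) (?T ?D ! i)"
      using dD i unfolding tensor_drazin_slicewise[OF t SK D] by blast
    from block_row_drazin[OF this cosine_transform_slice_carrier[OF SL i]]
    show ?thesis
      unfolding block_tensor_slices(2)[OF SK SL Z1 Z2 i] block_tensor_slices(2)[OF D C Z1 Z2 i]
        zero_tensor_slices(2)[OF i] TC rn .
  qed
  hence "monoid.drazin (tensor_monoid n1 n3) ?M ?Y"
    unfolding tensor_drazin_slicewise[OF t M Y] by blast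
  hence "monoid.drazin (tensor_monoid n1 n3) (U *\<^sub>c ?M *\<^sub>c U\<^sup>H) (U *\<^sub>c ?Y *\<^sub>c U\<^sup>H)"
    using monoid.drazin_conjugate[OF monoid_tensors[OF t], of n1 ?M ?Y U "U\<^sup>H"] U UH UHU UUH
    by simp
  thus ?thesis unfolding AU[symmetric] by (rule drazin_inverse_eqI[OF t A])
qed

end
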